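(* Let $N$ be an ordered negative support family for $\mathbf v_0$. If $$\langle A\mathbf t\rangle\cap\widehat M_N=\langle A\mathbf t\rangle\widehat M_N,$$ then $$\Phi(\widehat Q_N:\widehat m_N(\mathbf t))=P_N:m_N(\mathbf s).$$
   Context: $\mathbb N$ is the set of nonnegative integers. Let $A=(\mathbf a_1,\dots,\mathbf a_n)=(a_{ij})$ be a $d\times n$ integer matrix of rank $d$ whose columns all lie in a single affine hyperplane of $\mathbb Q^d$ not passing through the origin. Put $L=\operatorname{Ker}_{\mathbb Z}(A)\subset\mathbb Z^n$ and $L_{\mathbb C}=\operatorname{Ker}_{\mathbb C}(A)$. The toric ideal is $I_A=\langle\partial_{\mathbf x}^{\mathbf u}-\partial_{\mathbf x}^{\mathbf v}\mid A\mathbf u=A\mathbf v,\ \mathbf u,\mathbf v\in\mathbb N^n\rangle\subset\mathbb C[\partial_1,\dots,\partial_n]$. For $\boldsymbol\beta\in\mathbb C^d$, $H_A(\boldsymbol\beta)$ is the left ideal of the Weyl algebra $D$ in $x_j,\partial_j$ generated by $I_A$ and the operators $\sum_j a_{ij}\theta_j-\beta_i$ ($1\le i\le d$), $\theta_j=x_j\partial_j$. Fix a generic weight $\mathbf w\in\mathbb R^n$, i.e. such that $\operatorname{in}_{\mathbf w}(I_A)$ (generated by the parts of maximal $\mathbf w$-weight of elements of $I_A$) is a monomial ideal, and a fake exponent $\mathbf v_0\in\mathbb C^n$ of $H_A(\boldsymbol\beta)$ with respect to $\mathbf w$, i.e. a zero of $(D\operatorname{in}_{\mathbf w}(I_A)\cap\mathbb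 C[\boldsymbol\theta])+\langle A\boldsymbol\theta-\boldsymbol\beta\rangle\subset\mathbb C[\boldsymbol\theta]$. For $\mathbf u\in L$ put $I_{\mathbf u}=\{j\mid(\mathbf v_0+\mathbf u)_j\in\mathbb Z_{<0}\}$; put $\mathrm{NS}=\{I_{\mathbf u}\mid\mathbf u\in L\}$ and $\mathcal N_{\mathbf v_0}=\{I\in\mathrm{NS}\mid \mathbf w\cdot\mathbf u\ge0\text{ for every }\mathbf u\in L\text{ with }I_{\mathbf u}=I\}$. A negative support family for $\mathbf v_0$ is a set $N$ with $I_{\mathbf 0}\in N\subset\mathcal N_{\mathbf v_0}$; it is ordered if $I\in N$, $J\in\mathrm{NS}$, $J\subset I$ imply $J\in N$. Put $N^c=\mathrm{NS}\setminus N$ and $K_N=\bigcap_{I\in N}I$. Ambient side: $\mathbf t=(t_1,\dots,t_n)$, $\mathbf t^S=\prod_{j\in S}t_j$ (empty product $=1$). In $\mathbb C[[\mathbf t]]$ put $\widehat m_N(\mathbf t)=\mathbf t^{I_{\mathbf 0}\setminus K_N}$, $\widehat M_N=\langle\mathbf t^{I\setminus K_N}\mid I\in N\rangle$, $\widehat P_N=\langle\mathbf t^{(I\cup J)\setminus K_N}\mid I\in N,J\in N^c\rangle$, $\langle A\mathbf t\rangle=\langle\sum_j a_{ij}t_j\mid1\le i\le d\rangle$, $\widehat Q_N=\langle A\mathbf t\rangle\widehat M_N+\widehat P_N$. Intrinsic side: fix a basis $\mathbf b^{(1)},\dots,\mathbf b^{(n-d)}$ of $L_{\mathbb C}$, also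 viewed as the matrix $B$ with these columns; $\mathbf s=(s_1,\dots,s_{n-d})$, $(B\mathbf s)_j=\sum_k b^{(k)}_j s_k$, $(B\mathbf s)^S=\prod_{j\in S}(B\mathbf s)_j$. In $\mathbb C[[\mathbf s]]$ put $m_N(\mathbf s)=(B\mathbf s)^{I_{\mathbf 0}\setminus K_N}$ and $P_N=\langle(B\mathbf s)^{(I\cup J)\setminus K_N}\mid I\in N,J\in N^c\rangle$. $\Phi:\mathbb C[[\mathbf t]]\to\mathbb C[[\mathbf s]]$ is the $\mathbb C$-algebra homomorphism $f\mapsto f((B\mathbf s)_1,\dots,(B\mathbf s)_n)$. $J:m=\{f\mid fm\in J\}$ (formed in the respective power series ring). *)

theory Defs
  imports
    "HOL-Analysis.Analysis"
    "HOL-Algebra.Ideal_Product"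
    "HOL-Library.Poly_Mapping"
begin

section \<open>Multivariate polynomials and the Weyl algebra\<close>

text \<open>
  An exponent vector \<^term>\<open>u :: 'n \<Rightarrow>\<^sub>0 nat\<close> stands for a monomial. The type \<open>'n cpoly\<close> serves as
  \<open>\<complex>[x]\<close>, \<open>\<complex>[\<partial>]\<close> and \<open>\<complex>[\<theta>]\<close> alike.
\<close>

abbreviation lookup :: "('a \<Rightarrow>\<^sub>0 'b::zero) \<Rightarrow> 'a \<Rightarrow> 'b" where
  "lookup \<equiv> Poly_Mapping.lookup"

type_synonym 'n cpoly = "('n \<Rightarrow>\<^sub>0 nat) \<Rightarrow>\<^sub>0 complex"

abbreviation cmonom :: "('n \<Rightarrow>\<^sub>0 nat) \<Rightarrow> 'n cpoly" where
  "cmonom u \<equiv> Poly_Mapping.single u 1"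

abbreviation cconst :: "complex \<Rightarrow> 'n cpoly" where
  "cconst c \<equiv> Poly_Mapping.single 0 c"

abbreviation cvar :: "'n \<Rightarrow> 'n cpoly" where
  "cvar j \<equiv> cmonom (Poly_Mapping.single j 1)"

definition cpoly_eval :: "complex^'n \<Rightarrow> 'n::finite cpoly \<Rightarrow> complex" where
  "cpoly_eval v p = (\<Sum>u\<in>Poly_Mapping.keys p. lookup p u * (\<Prod>j\<in>UNIV. (v $ j) ^ lookup u j))"

definition poly_ideal :: "'n cpoly set \<Rightarrow> 'n cpoly set" where
  "poly_ideal S = module.span (*) S"

text \<open>The operators \<open>x\<^sub>j\<close>, \<open>\<partial>\<^sub>j\<close> and \<open>\<theta>\<^sub>j = x\<^sub>j \<partial>\<^sub>j\<close> acting on \<open>\<complex>[x]\<close>.\<close>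

type_synonym 'n cop = "'n cpoly \<Rightarrow> 'n cpoly"

definition x_op :: "'n \<Rightarrow> 'n cop" where
  "x_op j p = cvar j * p"

definition d_op :: "'n \<Rightarrow> 'n cop" where
  "d_op j p = (\<Sum>u\<in>Poly_Mapping.keys p.
     Poly_Mapping.single (u - Poly_Mapping.single j 1) (of_nat (lookup u j) * lookup p u))"

definition theta_op :: "'n \<Rightarrow> 'n cop" where
  "theta_op j = x_op j \<circ> d_op j"

text \<open>
  The Weyl algebra \<open>D\<close> is the algebra of differential operators on \<open>\<complex>[x]\<close> with polynomial
  coefficients; its product is composition.
\<close>

inductive_set weyl :: "'n cop set" where
  scalar: "(\<lambda>f. cconst c * f) \<in> weyl"
| x: "x_op j \<in> weyl"
| d: "d_op j \<in> weyl"
| add: "P \<in> weyl \<Longrightarrow> Q \<in> weyl \<Longrightarrow> (\<lambda>f. P f + Q f) \<in> weyl"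
| comp: "P \<in> weyl \<Longrightarrow> Q \<in> weyl \<Longrightarrow> P \<circ> Q \<in> weyl"

inductive_set weyl_left_ideal :: "'n cop set \<Rightarrow> 'n cop set" for G where
  zero: "(\<lambda>f. 0) \<in> weyl_left_ideal G"
| add_mult: "P \<in> weyl \<Longrightarrow> g \<in> G \<Longrightarrow> Q \<in> weyl_left_ideal G
    \<Longrightarrow> (\<lambda>f. P (g f) + Q f) \<in> weyl_left_ideal G"

text \<open>
  Substitution of a family of pairwise commuting operators \<open>T\<close> for the variables of a polynomial.
  The order of the factors in the fold is irrelevant for such \<open>T\<close>
  (lemmas \<open>comp_fun_commute_d_op\<close> and \<open>comp_fun_commute_theta_op\<close> below).
\<close>

definition op_monom :: "('n::finite \<Rightarrow> 'n cop) \<Rightarrow> ('n \<Rightarrow>\<^sub>0 nat) \<Rightarrow> 'n cop" where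
  "op_monom T u = Finite_Set.fold (\<lambda>j F. (T j ^^ lookup u j) \<circ> F) id UNIV"

definition op_eval :: "('n::finite \<Rightarrow> 'n cop) \<Rightarrow> 'n cpoly \<Rightarrow> 'n cop" where
  "op_eval T p = (\<lambda>f. \<Sum>u\<in>Poly_Mapping.keys p. cconst (lookup p u) * op_monom T u f)"

lemma lookup_d_op:
  "lookup (d_op j p) m =
     of_nat (lookup m j + 1) * lookup p (m + Poly_Mapping.single j 1)"
proof -
  let ?e = "Poly_Mapping.single j (1::nat)"
  have eq: "u = m + ?e" if "u - ?e = m" "lookup u j \<noteq> 0" for u
  proof (rule poly_mapping_eqI)
    fix k
    have "lookup (u - ?e) k = lookup m k" using that by simp
    then show "lookup u k = lookup (m + ?e) k"
      using that(2) by (cases "k = j") (auto simp: lookup_minus lookup_add lookup_single)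
  qed
  have "lookup (d_op j p) m = (\<Sum>u\<in>Poly_Mapping.keys p.
      (of_nat (lookup u j) * lookup p u when u - ?e = m))"
    by (simp add: d_op_def lookup_sum lookup_single)
  also have "\<dots> = (\<Sum>u\<in>Poly_Mapping.keys p.
      (if u = m + ?e then of_nat (lookup u j) * lookup p u else 0))"
    using eq by (intro sum.cong) (auto simp: when_def)
  also have "\<dots> = of_nat (lookup m j + 1) * lookup p (m + ?e)"
    by (auto simp: sum.delta lookup_add lookup_single in_keys_iff)
  finally show ?thesis .
qed

lemma lookup_x_op:
  "lookup (x_op j p) m =
     (if lookup m j = 0 then 0 else lookup p (m - Poly_Mapping.single j 1))"
proof -
  let ?e = "Poly_Mapping.single j (1::nat)"
  have *: "lookup (x_op j p) m = (\<Sum>q. lookup p q when m = ?e + q)"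
    by (simp add: x_op_def times_poly_mapping.rep_eq prod_fun_def lookup_single when_mult)
  show ?thesis
  proof (cases "lookup m j = 0")
    case True
    then have "m \<noteq> ?e + q" for q by (auto simp: lookup_add)
    with * True show ?thesis by simp
  next
    case False
    have "m = ?e + (m - ?e)"
      using False by (intro poly_mapping_eqI) (auto simp: lookup_add lookup_minus lookup_single when_def)
    then have "m = ?e + q \<longleftrightarrow> q = m - ?e" for q by auto
    with * False show ?thesis by simp
  qed
qed

lemma lookup_theta_op: "lookup (theta_op j p) m = of_nat (lookup m j) * lookup p m"
proof (cases "lookup m j = 0")
  case False
  have "m - Poly_Mapping.single j 1 + Poly_Mapping.single j 1 = m"
    using False by (intro poly_mapping_eqI) (auto simp: lookup_add lookup_minus lookup_single when_def)
  moreover have "lookup (m - Poly_Mapping.single j 1) j + 1 = lookup m j"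
    using False by (simp add: lookup_minus)
  ultimately show ?thesis
    using False by (simp only: theta_op_def o_def lookup_x_op lookup_d_op if_False)
qed (simp add: theta_op_def lookup_x_op)

lemma d_op_commute: "d_op i (d_op j p) = d_op j (d_op i p)"
  by (rule poly_mapping_eqI) 
     (cases "i = j", auto simp: lookup_d_op lookup_add lookup_single add_ac mult_ac)

lemma theta_op_commute: "theta_op i (theta_op j p) = theta_op j (theta_op i p)"
  by (rule poly_mapping_eqI) (simp add: lookup_theta_op)

lemma funpow_commute:
  assumes "\<And>x. f (g x) = g (f x)"
  shows "(f ^^ a) ((g ^^ b) x) = (g ^^ b) ((f ^^ a) x)"
proof -
  have *: "f ((g ^^ b) x) = (g ^^ b) (f x)" for x b
    by (induction b) (simp_all add: assms)
  show ?thesis by (induction a) (simp_all add: *)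
qed

lemma comp_fun_commute_d_op: "comp_fun_commute (\<lambda>j F. (d_op j ^^ e j) \<circ> F)"
  by standard (auto simp: fun_eq_iff intro!: funpow_commute d_op_commute)

lemma comp_fun_commute_theta_op: "comp_fun_commute (\<lambda>j F. (theta_op j ^^ e j) \<circ> F)"
  by standard (auto simp: fun_eq_iff intro!: funpow_commute theta_op_commute)

section \<open>Toric ideals, initial ideals, fake exponents\<close>

definition expvec :: "('n \<Rightarrow>\<^sub>0 nat) \<Rightarrow> int^'n::finite" where
  "expvec u = (\<chi> j. int (lookup u j))"

definition toric_ideal :: "int^'n^'d \<Rightarrow> 'n::finite cpoly set" where
  "toric_ideal A = poly_ideal {cmonom u - cmonom v | u v. A *v expvec u = A *v expvec v}"

definition wdot :: "real^'n \<Rightarrow> int^'n::finite \<Rightarrow> real" where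
  "wdot w u = w \<bullet> (\<chi> j. real_of_int (u $ j))"

definition initial_form :: "real^'n \<Rightarrow> 'n::finite cpoly \<Rightarrow> 'n cpoly" where
  "initial_form w f =
     (\<Sum>u\<in>{u \<in> Poly_Mapping.keys f.
            \<forall>u'\<in>Poly_Mapping.keys f. wdot w (expvec u') \<le> wdot w (expvec u)}.
        Poly_Mapping.single u (lookup f u))"

definition initial_ideal :: "real^'n \<Rightarrow> 'n::finite cpoly set \<Rightarrow> 'n cpoly set" where
  "initial_ideal w I = poly_ideal (initial_form w ` I)"

definition monomial_ideal :: "'n cpoly set \<Rightarrow> bool" where
  "monomial_ideal I \<longleftrightarrow> (\<exists>U. I = poly_ideal (cmonom ` U))"

definition generic_weight :: "int^'n^'d \<Rightarrow> real^'n::finite \<Rightarrow> bool" where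
  "generic_weight A w \<longleftrightarrow> monomial_ideal (initial_ideal w (toric_ideal A))"

text \<open>
  \<open>D in\<^sub>w(I\<^sub>A) \<inter> \<complex>[\<theta>]\<close>, as a set of polynomials \<open>p\<close> in commuting indeterminates: \<open>p\<close> belongs to it
  iff the operator \<open>p(\<theta>)\<close> lies in \<open>D in\<^sub>w(I\<^sub>A)\<close>. The operators \<open>\<theta>\<^sub>j\<close> are algebraically
  independent, so \<open>p\<close> is determined by \<open>p(\<theta>)\<close>.
\<close>

definition theta_part :: "int^'n^'d \<Rightarrow> real^'n::finite \<Rightarrow> 'n cpoly set" where
  "theta_part A w = {p. op_eval theta_op p \<in>
     weyl_left_ideal (op_eval d_op ` initial_ideal w (toric_ideal A))}"

definition euler_ideal :: "int^'n^'d \<Rightarrow> complex^'d \<Rightarrow> 'n::finite cpoly set" where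
  "euler_ideal A \<beta> = poly_ideal
     (range (\<lambda>i. (\<Sum>j\<in>UNIV. cconst (of_int (A $ i $ j)) * cvar j) - cconst (\<beta> $ i)))"

definition fake_exponent ::
  "int^'n^'d \<Rightarrow> complex^'d \<Rightarrow> real^'n \<Rightarrow> complex^'n::finite \<Rightarrow> bool" where
  "fake_exponent A \<beta> w v \<longleftrightarrow>
     (\<forall>p\<in>theta_part A w. \<forall>q\<in>euler_ideal A \<beta>. cpoly_eval v (p + q) = 0)"

section \<open>Lattice kernel and negative supports\<close>

definition int_kernel :: "int^'n^'d \<Rightarrow> (int^'n::finite) set" where
  "int_kernel A = {u. A *v u = 0}"

definition complex_kernel :: "int^'n^'d \<Rightarrow> (complex^'n::finite) set" where
  "complex_kernel A = {x. map_matrix of_int A *v x = 0}"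

text \<open>The columns of \<open>A\<close> satisfy one equation \<open>h \<bullet> y = c\<close> with \<open>c \<noteq> 0\<close>; then \<open>h \<noteq> 0\<close>.\<close>

definition columns_on_hyperplane :: "int^'n^'d::finite \<Rightarrow> bool" where
  "columns_on_hyperplane A \<longleftrightarrow>
     (\<exists>(h::rat^'d) c. c \<noteq> 0 \<and> (\<forall>j. (\<Sum>i\<in>UNIV. h $ i * of_int (A $ i $ j)) = c))"

definition nsupp :: "complex^'n \<Rightarrow> int^'n \<Rightarrow> 'n::finite set" where
  "nsupp v u = {j. \<exists>k::int. k < 0 \<and> v $ j + of_int (u $ j) = of_int k}"

definition NS :: "int^'n^'d \<Rightarrow> complex^'n \<Rightarrow> 'n::finite set set" where
  "NS A v = nsupp v ` int_kernel A"

text \<open>\<open>NS_min A w v\<close> is the set usually written \<open>\<N>\<^sub>v\<close>.\<close>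

definition NS_min :: "int^'n^'d \<Rightarrow> real^'n \<Rightarrow> complex^'n \<Rightarrow> 'n::finite set set" where
  "NS_min A w v = {I \<in> NS A v. \<forall>u\<in>int_kernel A. nsupp v u = I \<longrightarrow> 0 \<le> wdot w u}"

definition negative_support_family ::
  "int^'n^'d \<Rightarrow> real^'n \<Rightarrow> complex^'n \<Rightarrow> 'n::finite set set \<Rightarrow> bool" where
  "negative_support_family A w v N \<longleftrightarrow> nsupp v 0 \<in> N \<and> N \<subseteq> NS_min A w v"

definition ordered_family :: "int^'n^'d \<Rightarrow> complex^'n \<Rightarrow> 'n::finite set set \<Rightarrow> bool" where
  "ordered_family A v N \<longleftrightarrow> (\<forall>I\<in>N. \<forall>J\<in>NS A v. J \<subseteq> I \<longrightarrow> J \<in> N)"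

section \<open>Formal power series rings\<close>

text \<open>
  \<open>mps_ring V\<close> is the ring of formal power series in the variables \<open>V\<close>; a series is its
  coefficient function. Variables range over a subset of a type, and not over a whole type, so that
  an empty set of variables is possible.
\<close>

type_synonym ('v, 'a) mps = "('v \<Rightarrow>\<^sub>0 nat) \<Rightarrow> 'a"

definition mps_ring :: "'v set \<Rightarrow> ('v, 'a::comm_ring_1) mps ring" where
  "mps_ring V = \<lparr>carrier = {f. \<forall>m. f m \<noteq> 0 \<longrightarrow> Poly_Mapping.keys m \<subseteq> V},
     mult = (\<lambda>f g m. \<Sum>(a, b)\<in>{(a, b). a + b = m}. f a * g b),
     one = (\<lambda>m. if m = 0 then 1 else 0),
     zero = (\<lambda>m. 0),
     add = (\<lambda>f g m. f m + g m)\<rparr>"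

definition mps_const :: "'a \<Rightarrow> ('v, 'a::comm_ring_1) mps" where
  "mps_const c = (\<lambda>m. if m = 0 then c else 0)"

definition mps_var :: "'v \<Rightarrow> ('v, 'a::comm_ring_1) mps" where
  "mps_var i = (\<lambda>m. if m = Poly_Mapping.single i 1 then 1 else 0)"

definition mps_linear :: "'v set \<Rightarrow> ('v \<Rightarrow> 'a) \<Rightarrow> ('v, 'a::comm_ring_1) mps" where
  "mps_linear V c =
     (\<Oplus>\<^bsub>mps_ring V\<^esub>k\<in>V. mps_const (c k) \<otimes>\<^bsub>mps_ring V\<^esub> mps_var k)"

text \<open>
  Substitution \<open>f \<mapsto> f(l\<^sub>1, l\<^sub>2, \<dots>) = \<Sum>\<^sub>\<alpha> f\<^sub>\<alpha> l\<^sup>\<alpha>\<close>, taken coefficientwise. When the \<open>l\<^sub>j\<close> have no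
  constant term, each coefficient is a sum with finitely many nonzero terms
  (lemma \<open>finite_mps_subst\<close> below).
\<close>

definition mps_subst ::
  "'v set \<Rightarrow> ('n::finite \<Rightarrow> ('v, 'a) mps) \<Rightarrow> ('n, 'a) mps \<Rightarrow> ('v, 'a::comm_ring_1) mps" where
  "mps_subst V l f = (\<lambda>m. Sum_any (\<lambda>\<alpha>.
     f \<alpha> * (\<Otimes>\<^bsub>mps_ring V\<^esub>j\<in>UNIV. l j [^]\<^bsub>mps_ring V\<^esub> lookup \<alpha> j) m))"

definition ideal_colon :: "('a, 'b) ring_scheme \<Rightarrow> 'a set \<Rightarrow> 'a \<Rightarrow> 'a set" where
  "ideal_colon R J m = {f \<in> carrier R. f \<otimes>\<^bsub>R\<^esub> m \<in> J}"


lemma mps_ring_simps: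
  "carrier (mps_ring V) = {f. \<forall>m. f m \<noteq> 0 \<longrightarrow> Poly_Mapping.keys m \<subseteq> V}"
  "f \<otimes>\<^bsub>mps_ring V\<^esub> g = (\<lambda>m. \<Sum>(a, b)\<in>{(a, b). a + b = m}. f a * g b)"
  "\<one>\<^bsub>mps_ring V\<^esub> = (\<lambda>m. if m = 0 then 1 else 0)"
  "\<zero>\<^bsub>mps_ring V\<^esub> = (\<lambda>m. 0)"
  "f \<oplus>\<^bsub>mps_ring V\<^esub> g = (\<lambda>m. f m + g m)"
  by (simp_all add: mps_ring_def)

lemma finite_bounded_exponents:
  fixes m :: "'v \<Rightarrow>\<^sub>0 nat"
  shows "finite {a. \<forall>i. lookup a i \<le> lookup m i}"
proof -
  let ?r = "\<lambda>a. restrict (lookup a) (Poly_Mapping.keys m)"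
  let ?S = "{a. \<forall>i. lookup a i \<le> lookup m i}"
  have "?r ` ?S \<subseteq> Pi\<^sub>E (Poly_Mapping.keys m) (\<lambda>i. {..lookup m i})" by auto
  moreover have "finite (Pi\<^sub>E (Poly_Mapping.keys m) (\<lambda>i. {..lookup m i}))"
    by (intro finite_PiE) auto
  ultimately have "finite (?r ` ?S)" by (rule finite_subset)
  moreover have "inj_on ?r ?S"
  proof (rule inj_onI, rule poly_mapping_eqI)
    fix a b k assume ab: "a \<in> ?S" "b \<in> ?S" "?r a = ?r b"
    show "lookup a k = lookup b k"
    proof (cases "k \<in> Poly_Mapping.keys m")
      case True
      then show ?thesis using fun_cong[OF ab(3), of k] by simp
    next
      case False
      then have "lookup m k = 0" by (simp add: in_keys_iff)
      then show ?thesis using ab(1,2) by (metis le_zero_eq mem_Collect_eq)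
    qed
  qed
  ultimately show ?thesis by (rule finite_imageD)
qed

lemma finite_splits: "finite {(a, b). a + b = (m :: 'v \<Rightarrow>\<^sub>0 nat)}"
proof (rule finite_subset)
  let ?S = "{a. \<forall>i. lookup a i \<le> lookup m i}"
  show "{(a, b). a + b = m} \<subseteq> ?S \<times> ?S" by (auto simp: lookup_add)
  show "finite (?S \<times> ?S)" by (intro finite_cartesian_product finite_bounded_exponents)
qed

lemma keys_add_nat:
  "Poly_Mapping.keys (a + b :: 'v \<Rightarrow>\<^sub>0 nat) = Poly_Mapping.keys a \<union> Poly_Mapping.keys b"
  by (auto simp: in_keys_iff lookup_add)

lemma mps_mult_assoc:
  "(f \<otimes>\<^bsub>mps_ring V\<^esub> g) \<otimes>\<^bsub>mps_ring V\<^esub> h = f \<otimes>\<^bsub>mps_ring V\<^esub> (g \<otimes>\<^bsub>mps_ring V\<^esub> h)"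
proof
  fix m
  have "((f \<otimes>\<^bsub>mps_ring V\<^esub> g) \<otimes>\<^bsub>mps_ring V\<^esub> h) m =
      (\<Sum>p\<in>{(a, b). a + b = m}. \<Sum>q\<in>{(a, b). a + b = fst p}. f (fst q) * g (snd q) * h (snd p))"
    by (simp add: mps_ring_simps sum_distrib_right case_prod_unfold)
  also have "\<dots> = (\<Sum>(p, q)\<in>(SIGMA p:{(a, b). a + b = m}. {(a, b). a + b = fst p}).
      f (fst q) * g (snd q) * h (snd p))"
    by (subst sum.Sigma) (simp_all add: finite_splits)
  also have "\<dots> = (\<Sum>(p, q)\<in>(SIGMA p:{(a, b). a + b = m}. {(a, b). a + b = snd p}).
      f (fst p) * (g (fst q) * h (snd q)))"
    by (rule sum.reindex_bij_witness
        [where i = "\<lambda>(p, q). ((fst p + fst q, snd q), (fst p, fst q))"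
           and j = "\<lambda>(p, q). ((fst q, snd q + snd p), (snd q, snd p))"])
       (auto simp: add_ac mult_ac)
  also have "\<dots> = (\<Sum>p\<in>{(a, b). a + b = m}. \<Sum>q\<in>{(a, b). a + b = snd p}.
      f (fst p) * (g (fst q) * h (snd q)))"
    by (subst sum.Sigma) (simp_all add: finite_splits)
  also have "\<dots> = (f \<otimes>\<^bsub>mps_ring V\<^esub> (g \<otimes>\<^bsub>mps_ring V\<^esub> h)) m"
    by (simp add: mps_ring_simps sum_distrib_left case_prod_unfold)
  finally show "((f \<otimes>\<^bsub>mps_ring V\<^esub> g) \<otimes>\<^bsub>mps_ring V\<^esub> h) m =
    (f \<otimes>\<^bsub>mps_ring V\<^esub> (g \<otimes>\<^bsub>mps_ring V\<^esub> h)) m" .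
qed

lemma mps_mult_commute: "f \<otimes>\<^bsub>mps_ring V\<^esub> g = g \<otimes>\<^bsub>mps_ring V\<^esub> f"
proof
  fix m
  show "(f \<otimes>\<^bsub>mps_ring V\<^esub> g) m = (g \<otimes>\<^bsub>mps_ring V\<^esub> f) m"
    unfolding mps_ring_simps
    by (rule sum.reindex_bij_witness[where i = "\<lambda>(a, b). (b, a)" and j = "\<lambda>(a, b). (b, a)"])
       (auto simp: add_ac mult_ac)
qed

lemma mps_one_mult: "\<one>\<^bsub>mps_ring V\<^esub> \<otimes>\<^bsub>mps_ring V\<^esub> f = f"
proof
  fix m
  have "(\<one>\<^bsub>mps_ring V\<^esub> \<otimes>\<^bsub>mps_ring V\<^esub> f) m =
      (\<Sum>p\<in>{(a, b). a + b = m}. if p = (0, m) then f m else 0)"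
    unfolding mps_ring_simps by (intro sum.cong) (auto split: if_splits)
  also have "\<dots> = f m" by (simp add: sum.delta finite_splits)
  finally show "(\<one>\<^bsub>mps_ring V\<^esub> \<otimes>\<^bsub>mps_ring V\<^esub> f) m = f m" .
qed

lemma mps_mult_closed:
  assumes "f \<in> carrier (mps_ring V)" "g \<in> carrier (mps_ring V)"
  shows "f \<otimes>\<^bsub>mps_ring V\<^esub> g \<in> carrier (mps_ring V)"
proof -
  have "Poly_Mapping.keys m \<subseteq> V" if nz: "(f \<otimes>\<^bsub>mps_ring V\<^esub> g) m \<noteq> 0" for m
  proof -
    obtain p where p: "p \<in> {(a, b). a + b = m}" "(case p of (a, b) \<Rightarrow> f a * g b) \<noteq> 0"
      using nz unfolding mps_ring_simps by (rule sum.not_neutral_contains_not_neutral)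
    obtain a b where ab: "p = (a, b)" by (cases p)
    with p have m: "a + b = m" and "f a * g b \<noteq> 0" by auto
    then have "f a \<noteq> 0" "g b \<noteq> 0" by auto
    then have "Poly_Mapping.keys a \<subseteq> V" "Poly_Mapping.keys b \<subseteq> V"
      using assms by (auto simp: mps_ring_simps)
    then show ?thesis unfolding m[symmetric] keys_add_nat by blast
  qed
  then show ?thesis by (simp add: mps_ring_simps(1))
qed

lemma cring_mps_ring: "cring (mps_ring V :: ('a, 'b::comm_ring_1) mps ring)"
proof (rule cringI)
  show "abelian_group (mps_ring V :: ('a, 'b) mps ring)"
  proof (rule abelian_groupI)
    fix f assume f: "f \<in> carrier (mps_ring V)"
    then show "\<exists>g\<in>carrier (mps_ring V). g \<oplus>\<^bsub>mps_ring V\<^esub> f = \<zero>\<^bsub>mps_ring V\<^esub>"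
      by (intro bexI[of _ "\<lambda>m. - f m"]) (auto simp: mps_ring_simps)
  next
    fix f g :: "('a, 'b) mps"
    assume "f \<in> carrier (mps_ring V)" "g \<in> carrier (mps_ring V)"
    then show "f \<oplus>\<^bsub>mps_ring V\<^esub> g \<in> carrier (mps_ring V)"
      unfolding mps_ring_simps(1) mps_ring_simps(5) mem_Collect_eq
      by (metis add.right_neutral)
  qed (simp_all add: mps_ring_simps add_ac)
  show "comm_monoid (mps_ring V :: ('a, 'b) mps ring)"
  proof (rule comm_monoidI)
    show "\<one>\<^bsub>mps_ring V\<^esub> \<in> carrier (mps_ring V)" by (auto simp: mps_ring_simps)
  qed (simp_all only: mps_mult_assoc mps_one_mult mps_mult_closed, rule mps_mult_commute)
  show "(f \<oplus>\<^bsub>mps_ring V\<^esub> g) \<otimes>\<^bsub>mps_ring V\<^esub> h =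
      f \<otimes>\<^bsub>mps_ring V\<^esub> h \<oplus>\<^bsub>mps_ring V\<^esub> g \<otimes>\<^bsub>mps_ring V\<^esub> h" for f g h :: "('a, 'b) mps"
    by (simp add: mps_ring_simps distrib_right sum.distrib case_prod_unfold)
qed

definition mps_ord_ge :: "nat \<Rightarrow> ('v, 'a::comm_ring_1) mps \<Rightarrow> bool" where
  "mps_ord_ge n f \<longleftrightarrow>
     (\<forall>m. f m \<noteq> 0 \<longrightarrow> (\<forall>S. finite S \<longrightarrow> Poly_Mapping.keys m \<subseteq> S \<longrightarrow> n \<le> sum (lookup m) S))"

lemma mps_ord_ge_mult:
  assumes "mps_ord_ge n f" "mps_ord_ge k g"
  shows "mps_ord_ge (n + k) (f \<otimes>\<^bsub>mps_ring V\<^esub> g)"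
  unfolding mps_ord_ge_def
proof (intro allI impI)
  fix m S
  assume nz: "(f \<otimes>\<^bsub>mps_ring V\<^esub> g) m \<noteq> 0" and S: "finite S" "Poly_Mapping.keys m \<subseteq> S"
  obtain p where p: "p \<in> {(a, b). a + b = m}" "(case p of (a, b) \<Rightarrow> f a * g b) \<noteq> 0"
    using nz unfolding mps_ring_simps by (rule sum.not_neutral_contains_not_neutral)
  obtain a b where ab: "p = (a, b)" by (cases p)
  with p have m: "a + b = m" and "f a * g b \<noteq> 0" by auto
  then have "f a \<noteq> 0" "g b \<noteq> 0" by auto
  moreover have "Poly_Mapping.keys a \<subseteq> S" "Poly_Mapping.keys b \<subseteq> S"
    using S(2) unfolding m[symmetric] keys_add_nat by auto
  ultimately have "n \<le> sum (lookup a) S" "k \<le> sum (lookup b) S"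
    using assms S(1) unfolding mps_ord_ge_def by blast+
  then show "n + k \<le> sum (lookup m) S"
    unfolding m[symmetric] by (simp add: lookup_add sum.distrib)
qed

lemma mps_ord_ge_one: "mps_ord_ge 0 (\<one>\<^bsub>mps_ring V\<^esub>)"
  by (simp add: mps_ord_ge_def)

lemma mps_ord_ge_pow:
  assumes "mps_ord_ge 1 f"
  shows "mps_ord_ge k (f [^]\<^bsub>mps_ring V\<^esub> (k::nat))"
proof (induction k)
  case 0
  interpret cring "mps_ring V" by (rule cring_mps_ring)
  show ?case by (simp add: mps_ord_ge_one)
next
  case (Suc k)
  interpret cring "mps_ring V" by (rule cring_mps_ring)
  show ?case using mps_ord_ge_mult[OF Suc assms, of V] by simp
qed

lemma finite_mps_subst:
  fixes l :: "'n::finite \<Rightarrow> ('v, 'a::comm_ring_1) mps" and f :: "('n, 'a) mps"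
  assumes l: "\<And>j. l j \<in> carrier (mps_ring V)" "\<And>j. l j 0 = 0"
  shows "finite {\<alpha>. f \<alpha> * (\<Otimes>\<^bsub>mps_ring V\<^esub>j\<in>UNIV. l j [^]\<^bsub>mps_ring V\<^esub> lookup \<alpha> j) m \<noteq> 0}"
proof -
  interpret cring "mps_ring V :: ('v, 'a) mps ring" by (rule cring_mps_ring)
  have ord1: "mps_ord_ge 1 (l j)" for j
    unfolding mps_ord_ge_def
  proof (intro allI impI)
    fix m S assume m: "l j m \<noteq> 0" and S: "finite S" "Poly_Mapping.keys m \<subseteq> S"
    have "m \<noteq> 0" using m l(2) by metis
    then obtain k where "k \<in> Poly_Mapping.keys m" by (metis all_not_in_conv keys_eq_empty)
    then have "k \<in> S" "lookup m k \<noteq> 0" using S(2) by (auto simp: in_keys_iff)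
    then show "1 \<le> sum (lookup m) S"
      using member_le_sum[of k S "lookup m"] S(1) by simp
  qed
  have "mps_ord_ge (\<Sum>j\<in>J. lookup \<alpha> j) (\<Otimes>\<^bsub>mps_ring V\<^esub>j\<in>J. l j [^]\<^bsub>mps_ring V\<^esub> lookup \<alpha> j)"
    if "finite J" for J :: "'n set" and \<alpha>
    using that
  proof (induction J)
    case empty
    then show ?case by (simp add: mps_ord_ge_one)
  next
    case (insert j J)
    then show ?case
      using mps_ord_ge_mult[OF mps_ord_ge_pow[OF ord1[of j]] insert.IH, of "lookup \<alpha> j" V] l(1)
      by (subst finprod_insert) auto
  qed
  from this[OF finite_class.finite_UNIV]
  have ordp: "mps_ord_ge (\<Sum>j\<in>UNIV. lookup \<alpha> j)
      (\<Otimes>\<^bsub>mps_ring V\<^esub>j\<in>UNIV. l j [^]\<^bsub>mps_ring V\<^esub> lookup \<alpha> j)" for \<alpha> .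
  have bound: "(\<Sum>j\<in>UNIV. lookup \<alpha> j) \<le> sum (lookup m) (Poly_Mapping.keys m)"
    if "(\<Otimes>\<^bsub>mps_ring V\<^esub>j\<in>UNIV. l j [^]\<^bsub>mps_ring V\<^esub> lookup \<alpha> j) m \<noteq> 0" for \<alpha>
    by (rule ordp[of \<alpha>, unfolded mps_ord_ge_def, rule_format, OF that]) simp_all
  define c :: "'n \<Rightarrow>\<^sub>0 nat" where
    "c = Abs_poly_mapping (\<lambda>_. sum (lookup m) (Poly_Mapping.keys m))"
  have c: "lookup c j = sum (lookup m) (Poly_Mapping.keys m)" for j
    by (simp add: c_def)
  show ?thesis
  proof (rule finite_subset[OF subsetI finite_bounded_exponents[of c]], intro CollectI allI)
    fix \<alpha> i
    assume "\<alpha> \<in> {\<alpha>. f \<alpha> * (\<Otimes>\<^bsub>mps_ring V\<^esub>j\<in>UNIV. l j [^]\<^bsub>mps_ring V\<^esub> lookup \<alpha> j) m \<noteq> 0}"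
    then have "(\<Otimes>\<^bsub>mps_ring V\<^esub>j\<in>UNIV. l j [^]\<^bsub>mps_ring V\<^esub> lookup \<alpha> j) m \<noteq> 0"
      by (metis (mono_tags, lifting) mem_Collect_eq mult_zero_right)
    then have "(\<Sum>j\<in>UNIV. lookup \<alpha> j) \<le> lookup c i" unfolding c by (rule bound)
    moreover have "lookup \<alpha> i \<le> (\<Sum>j\<in>UNIV. lookup \<alpha> j)" by (intro member_le_sum) auto
    ultimately show "lookup \<alpha> i \<le> lookup c i" by linarith
  qed
qed

section \<open>The ideals attached to a negative support family\<close>

text \<open>
  The elements and ideals below are taken in a ring \<open>R\<close> for given elements \<open>y\<^sub>j\<close>: on the ambient
  side \<open>R = \<complex>[[t]]\<close> and \<open>y\<^sub>j = t\<^sub>j\<close>, on the intrinsic side \<open>R = \<complex>[[s]]\<close> and \<open>y\<^sub>j = (B s)\<^sub>j\<close>.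
\<close>

definition m_elem ::
  "('r, 'b) ring_scheme \<Rightarrow> ('n \<Rightarrow> 'r) \<Rightarrow> complex^'n \<Rightarrow> 'n::finite set set \<Rightarrow> 'r" where
  "m_elem R y v N = (\<Otimes>\<^bsub>R\<^esub>j\<in>nsupp v 0 - \<Inter>N. y j)"

definition M_ideal ::
  "('r, 'b) ring_scheme \<Rightarrow> ('n \<Rightarrow> 'r) \<Rightarrow> 'n::finite set set \<Rightarrow> 'r set" where
  "M_ideal R y N = Idl\<^bsub>R\<^esub> {\<Otimes>\<^bsub>R\<^esub>j\<in>I - \<Inter>N. y j | I. I \<in> N}"

definition P_ideal ::
  "('r, 'b) ring_scheme \<Rightarrow> ('n \<Rightarrow> 'r) \<Rightarrow> int^'n^'d \<Rightarrow> complex^'n \<Rightarrow> 'n::finite set set \<Rightarrow> 'r set"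
  where
  "P_ideal R y A v N =
     Idl\<^bsub>R\<^esub> {\<Otimes>\<^bsub>R\<^esub>j\<in>(I \<union> J) - \<Inter>N. y j | I J. I \<in> N \<and> J \<in> NS A v - N}"

abbreviation t_ring :: "('n::finite, complex) mps ring" where
  "t_ring \<equiv> mps_ring UNIV"

definition m_hat :: "complex^'n \<Rightarrow> 'n::finite set set \<Rightarrow> ('n, complex) mps" where
  "m_hat v N = m_elem t_ring mps_var v N"

definition M_hat :: "'n::finite set set \<Rightarrow> ('n, complex) mps set" where
  "M_hat N = M_ideal t_ring mps_var N"

definition P_hat ::
  "int^'n^'d \<Rightarrow> complex^'n \<Rightarrow> 'n::finite set set \<Rightarrow> ('n, complex) mps set" where
  "P_hat A v N = P_ideal t_ring mps_var A v N"

definition At_ideal :: "int^'n^'d \<Rightarrow> ('n::finite, complex) mps set" where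
  "At_ideal A = Idl\<^bsub>t_ring\<^esub> (range (\<lambda>i. mps_linear UNIV (\<lambda>j. of_int (A $ i $ j))))"

definition Q_hat ::
  "int^'n^'d \<Rightarrow> complex^'n \<Rightarrow> 'n::finite set set \<Rightarrow> ('n, complex) mps set" where
  "Q_hat A v N = (At_ideal A \<cdot>\<^bsub>t_ring\<^esub> M_hat N) <+>\<^bsub>t_ring\<^esub> P_hat A v N"

text \<open>
  On the intrinsic side the variables are \<open>s\<^sub>k\<close> with \<open>k < r\<close>, where \<open>r = n - d\<close>, and the columns of
  \<open>B\<close> are \<open>b 0, \<dots>, b (r - 1)\<close>.
\<close>

definition is_basis_of :: "nat \<Rightarrow> (nat \<Rightarrow> complex^'n) \<Rightarrow> (complex^'n::finite) set \<Rightarrow> bool" where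
  "is_basis_of r b W \<longleftrightarrow>
     inj_on b {..<r} \<and> vec.independent (b ` {..<r}) \<and> vec.span (b ` {..<r}) = W"

abbreviation s_ring :: "nat \<Rightarrow> (nat, complex) mps ring" where
  "s_ring r \<equiv> mps_ring {..<r}"

definition Bs :: "nat \<Rightarrow> (nat \<Rightarrow> complex^'n) \<Rightarrow> 'n::finite \<Rightarrow> (nat, complex) mps" where
  "Bs r b j = mps_linear {..<r} (\<lambda>k. b k $ j)"

definition m_s :: "nat \<Rightarrow> (nat \<Rightarrow> complex^'n) \<Rightarrow> complex^'n \<Rightarrow> 'n::finite set set
    \<Rightarrow> (nat, complex) mps" where
  "m_s r b v N = m_elem (s_ring r) (Bs r b) v N"

definition P_s :: "nat \<Rightarrow> (nat \<Rightarrow> complex^'n) \<Rightarrow> int^'n^'d \<Rightarrow> complex^'n \<Rightarrow> 'n::finite set set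
    \<Rightarrow> (nat, complex) mps set" where
  "P_s r b A v N = P_ideal (s_ring r) (Bs r b) A v N"

definition Phi ::
  "nat \<Rightarrow> (nat \<Rightarrow> complex^'n) \<Rightarrow> ('n::finite, complex) mps \<Rightarrow> (nat, complex) mps" where
  "Phi r b = mps_subst {..<r} (Bs r b)"

end

theory Submission
  imports Defs "HOL-Algebra.QuotRing"
begin

text \<open>
  \<open>\<Phi>\<close> is surjective with kernel \<open>\<langle>A t\<rangle>\<close>. Given this, \<open>\<Phi>\<close> maps \<open>P\<close>-hat onto \<open>P\<close> and kills \<open>\<langle>A t\<rangle>\<close>, which
  gives one inclusion. For the other one, if \<open>\<Phi>(f) m \<in> P\<close>, then \<open>f m - p \<in> \<langle>A t\<rangle>\<close> (with \<open>m\<close> in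
  \<open>\<complex>[[t]]\<close>) for some \<open>p\<close> in \<open>P\<close>-hat; since \<open>m\<close> and \<open>p\<close> lie in \<open>M\<close>-hat, so does \<open>f m - p\<close>, and the
  hypothesis on the intersection puts it into \<open>\<langle>A t\<rangle> M\<close>-hat.

  For the kernel and the image, choose \<open>C\<close> with \<open>C B = 1\<close> and let \<open>\<sigma>\<close> be the substitution
  \<open>s \<mapsto> C t\<close>. For a substitution endomorphism \<open>E\<close>, every \<open>f - E f\<close> lies in the ideal generated by the
  \<open>t\<^sub>j - E t\<^sub>j\<close>. With \<open>E = \<Phi> \<circ> \<sigma>\<close> this ideal is zero, so \<open>\<Phi>\<close> is surjective. With \<open>E = \<sigma> \<circ> \<Phi>\<close> it
  is generated by linear forms vanishing on \<open>ker A\<close>, that is, by elements of the row space of \<open>A\<close>; so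
  \<open>\<Phi> f = 0\<close> implies \<open>f \<in> \<langle>A t\<rangle>\<close>.
\<close>

section \<open>Colon ideals under surjective homomorphisms\<close>

text \<open>One inclusion pulls the ideal on the right back to an ideal containing \<open>X\<close>.
  The other uses that, by surjectivity, the image of an ideal absorbs multiplication by all of
  \<open>S\<close>.\<close>

lemma (in ring_hom_cring) image_genideal:
  assumes surj: "h ` carrier R = carrier S" and X: "X \<subseteq> carrier R"
  shows "h ` (Idl\<^bsub>R\<^esub> X) = Idl\<^bsub>S\<^esub> (h ` X)"
proof (intro equalityI)
  have hX: "h ` X \<subseteq> carrier S" using X by auto
  interpret I: ideal "Idl\<^bsub>R\<^esub> X" R by (rule R.genideal_ideal[OF X])
  interpret J: ideal "Idl\<^bsub>S\<^esub> (h ` X)" S by (rule S.genideal_ideal[OF hX])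
  have H: "ring_hom_ring R S h"
    by (rule ring_hom_ringI2) (unfold_locales, rule homh)
  have "ideal {x \<in> carrier R. h x \<in> Idl\<^bsub>S\<^esub> (h ` X)} R"
    by (rule ring_hom_ring.ideal_vimage[OF H J.is_ideal])
  moreover have "X \<subseteq> {x \<in> carrier R. h x \<in> Idl\<^bsub>S\<^esub> (h ` X)}"
    using X S.genideal_self[OF hX] by auto
  ultimately show "h ` (Idl\<^bsub>R\<^esub> X) \<subseteq> Idl\<^bsub>S\<^esub> (h ` X)"
    using R.genideal_minimal by blast
  have "ideal (h ` (Idl\<^bsub>R\<^esub> X)) S"
  proof (rule idealI)
    show "subgroup (h ` (Idl\<^bsub>R\<^esub> X)) (add_monoid S)"
      by (rule ring_hom_ring.img_is_add_subgroup[OF H I.a_subgroup])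
    fix a x assume "a \<in> h ` (Idl\<^bsub>R\<^esub> X)" "x \<in> carrier S"
    then obtain a' x' where a': "a' \<in> Idl\<^bsub>R\<^esub> X" "a = h a'" and x': "x' \<in> carrier R" "x = h x'"
      using surj by (metis imageE)
    have "a' \<in> carrier R" using a' I.a_subset by blast
    then have "x \<otimes>\<^bsub>S\<^esub> a = h (x' \<otimes>\<^bsub>R\<^esub> a')" "a \<otimes>\<^bsub>S\<^esub> x = h (a' \<otimes>\<^bsub>R\<^esub> x')"
      using a' x' by simp_all
    then show "x \<otimes>\<^bsub>S\<^esub> a \<in> h ` (Idl\<^bsub>R\<^esub> X)" "a \<otimes>\<^bsub>S\<^esub> x \<in> h ` (Idl\<^bsub>R\<^esub> X)"
      using a' x' I.I_l_closed I.I_r_closed by blast+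
  qed unfold_locales
  then show "Idl\<^bsub>S\<^esub> (h ` X) \<subseteq> h ` (Idl\<^bsub>R\<^esub> X)"
    by (rule S.genideal_minimal) (use R.genideal_self[OF X] in blast)
qed

text \<open>The main argument for abstract commutative rings, with \<open>K\<close> in the role of
  \<open>At_ideal A\<close>. The identity \<open>KM\<close> serves both inclusions: it puts the
  product of \<open>K\<close> and \<open>M\<close> inside \<open>K\<close> for the first, and
  \<open>K \<inter> M\<close> inside the product for the second.\<close>

lemma (in ring_hom_cring) image_ideal_colon:
  assumes surj: "h ` carrier R = carrier S" and ker: "a_kernel R S h = K"
    and K: "ideal K R" and M: "ideal M R" and P: "ideal P R"
    and PM: "P \<subseteq> M" and m: "m \<in> M" and KM: "K \<inter> M = K \<cdot>\<^bsub>R\<^esub> M"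
  shows "h ` ideal_colon R (K \<cdot>\<^bsub>R\<^esub> M <+>\<^bsub>R\<^esub> P) m = ideal_colon S (h ` P) (h m)"
proof (intro equalityI subsetI)
  have ker_iff: "x \<in> K \<longleftrightarrow> x \<in> carrier R \<and> h x = \<zero>\<^bsub>S\<^esub>" for x
    unfolding ker[symmetric] a_kernel_def' by simp
  interpret K: ideal K R by fact
  interpret M: ideal M R by fact
  interpret P: ideal P R by fact
  have mc: "m \<in> carrier R" using m M.a_subset by auto
  fix g assume "g \<in> h ` ideal_colon R (K \<cdot>\<^bsub>R\<^esub> M <+>\<^bsub>R\<^esub> P) m"
  then obtain f where f: "f \<in> carrier R" "g = h f" "f \<otimes>\<^bsub>R\<^esub> m \<in> K \<cdot>\<^bsub>R\<^esub> M <+>\<^bsub>R\<^esub> P"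
    by (auto simp: ideal_colon_def)
  then obtain k p where kp: "k \<in> K" "p \<in> P" "f \<otimes>\<^bsub>R\<^esub> m = k \<oplus>\<^bsub>R\<^esub> p"
    using KM by (auto simp: set_add_def')
  have c: "k \<in> carrier R" "p \<in> carrier R" using kp K.a_subset P.a_subset by auto
  have "h k = \<zero>\<^bsub>S\<^esub>" using kp(1) unfolding ker_iff by simp
  then have "h (f \<otimes>\<^bsub>R\<^esub> m) = h p" unfolding kp(3) using c by simp
  then have "h f \<otimes>\<^bsub>S\<^esub> h m = h p" using f(1) mc by simp
  then show "g \<in> ideal_colon S (h ` P) (h m)"
    using f kp by (auto simp: ideal_colon_def)
next
  have ker_iff: "x \<in> K \<longleftrightarrow> x \<in> carrier R \<and> h x = \<zero>\<^bsub>S\<^esub>" for x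
    unfolding ker[symmetric] a_kernel_def' by simp
  interpret K: ideal K R by fact
  interpret M: ideal M R by fact
  interpret P: ideal P R by fact
  have mc: "m \<in> carrier R" using m M.a_subset by auto
  fix g assume "g \<in> ideal_colon S (h ` P) (h m)"
  then have "g \<in> h ` carrier R" "g \<otimes>\<^bsub>S\<^esub> h m \<in> h ` P"
    using surj by (auto simp: ideal_colon_def)
  then obtain f p where f: "f \<in> carrier R" "g = h f" and p: "p \<in> P" "h f \<otimes>\<^bsub>S\<^esub> h m = h p"
    by blast
  have pc: "p \<in> carrier R" using p P.a_subset by auto
  \<comment> \<open>Both \<open>f \<otimes> m\<close> and \<open>p\<close> are preimages of the same
    element of \<open>S\<close>, so their difference lies in the kernel.\<close>
  define k where "k = f \<otimes>\<^bsub>R\<^esub> m \<ominus>\<^bsub>R\<^esub> p"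
  have "h k = \<zero>\<^bsub>S\<^esub>" using f p pc mc unfolding k_def R.minus_eq
    by (simp add: S.r_neg)
  then have "k \<in> K" unfolding ker_iff k_def using f(1) mc pc by simp
  \<comment> \<open>Membership of \<open>m\<close> in \<open>M\<close> and the inclusion of
    \<open>P\<close> in \<open>M\<close> place the kernel element in \<open>K \<inter> M\<close>,
    where the intersection hypothesis applies.\<close>
  moreover have "k \<in> M"
    unfolding k_def R.minus_eq using f m p(1) PM by (auto intro: M.I_l_closed)
  ultimately have "k \<in> K \<cdot>\<^bsub>R\<^esub> M" using KM by blast
  moreover have "f \<otimes>\<^bsub>R\<^esub> m = k \<oplus>\<^bsub>R\<^esub> p"
    using f mc pc unfolding k_def R.minus_eq by (simp add: R.a_assoc R.l_neg)
  ultimately have "f \<otimes>\<^bsub>R\<^esub> m \<in> K \<cdot>\<^bsub>R\<^esub> M <+>\<^bsub>R\<^esub> P" using p(1) by (auto simp: set_add_def')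
  then show "g \<in> h ` ideal_colon R (K \<cdot>\<^bsub>R\<^esub> M <+>\<^bsub>R\<^esub> P) m"
    using f by (auto simp: ideal_colon_def)
qed

text \<open>Homomorphisms commute with finite products, so generators go to generators with the same
  index sets. For \<Phi> this turns \<open>P_hat\<close> into \<open>P_s\<close>.\<close>

lemma (in ring_hom_cring) image_P_ideal:
  fixes y :: "'z::finite \<Rightarrow> 'a"
  assumes "h ` carrier R = carrier S" "\<And>j. y j \<in> carrier R"
  shows "h ` P_ideal R y A v N = P_ideal S (\<lambda>j. h (y j)) A v N"
proof -
  have "h (\<Otimes>\<^bsub>R\<^esub>j\<in>J. y j) = (\<Otimes>\<^bsub>S\<^esub>j\<in>J. h (y j))" for J
    using assms(2) by (subst hom_finprod) (auto simp: o_def)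
  moreover have "h ` {f I J | I J. C I J} = {h (f I J) | I J. C I J}"
    for f :: "'z set \<Rightarrow> 'z set \<Rightarrow> 'a" and C by blast
  ultimately have eq: "h ` {\<Otimes>\<^bsub>R\<^esub>j\<in>(I \<union> J) - \<Inter>N. y j | I J. I \<in> N \<and> J \<in> NS A v - N} =
      {\<Otimes>\<^bsub>S\<^esub>j\<in>(I \<union> J) - \<Inter>N. h (y j) | I J. I \<in> N \<and> J \<in> NS A v - N}"
    by simp
  have "{\<Otimes>\<^bsub>R\<^esub>j\<in>(I \<union> J) - \<Inter>N. y j | I J. I \<in> N \<and> J \<in> NS A v - N} \<subseteq> carrier R"
    using assms(2) by auto
  from image_genideal[OF assms(1) this] show ?thesis unfolding P_ideal_def eq .
qed

text \<open>The generator indexed by \<open>I\<close> and \<open>J\<close> is a multiple of the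
  generator of \<open>M_ideal\<close> indexed by \<open>I\<close>, with cofactor the product over
  \<open>J - I - \<Inter>N\<close>.\<close>

lemma (in cring) P_ideal_subset_M_ideal:
  assumes y: "\<And>j. y j \<in> carrier R"
  shows "P_ideal R y A v N \<subseteq> M_ideal R y N"
  unfolding P_ideal_def
proof (rule genideal_minimal)
  have gc: "{\<Otimes>j\<in>I - \<Inter>N. y j |I. I \<in> N} \<subseteq> carrier R" using y by auto
  show M: "ideal (M_ideal R y N) R" unfolding M_ideal_def by (rule genideal_ideal[OF gc])
  show "{\<Otimes>j\<in>I \<union> J - \<Inter>N. y j |I J. I \<in> N \<and> J \<in> NS A v - N} \<subseteq> M_ideal R y N"
  proof clarify
    fix I J assume I: "I \<in> N"
    have "(\<Otimes>j\<in>I \<union> J - \<Inter>N. y j) = (\<Otimes>j\<in>(I - \<Inter>N) \<union> (J - I - \<Inter>N). y j)"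
      by (rule arg_cong[where f="finprod R y"]) blast
    also have "\<dots> = (\<Otimes>j\<in>I - \<Inter>N. y j) \<otimes> (\<Otimes>j\<in>J - I - \<Inter>N. y j)"
      by (rule finprod_Un_disjoint) (use y in auto)
    also have "\<dots> \<in> M_ideal R y N"
    proof (rule ideal.I_r_closed[OF M])
      show "(\<Otimes>j\<in>I - \<Inter>N. y j) \<in> M_ideal R y N"
        unfolding M_ideal_def using I genideal_self[OF gc] by blast
    qed (use y in auto)
    finally show "(\<Otimes>j\<in>I \<union> J - \<Inter>N. y j) \<in> M_ideal R y N" .
  qed
qed

lemma (in cring) m_elem_in_M_ideal:
  assumes "\<And>j. y j \<in> carrier R" "nsupp v 0 \<in> N"
  shows "m_elem R y v N \<in> M_ideal R y N"
proof -
  have "{\<Otimes>j\<in>I - \<Inter>N. y j |I. I \<in> N} \<subseteq> carrier R" using assms by auto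
  from genideal_self[OF this] show ?thesis
    using assms(2) unfolding M_ideal_def m_elem_def by blast
qed

section \<open>Dual vectors and annihilators\<close>

lemma span_sum_zero:
  fixes x :: "'n::finite \<Rightarrow> 'a::field"
  assumes "\<And>z. z \<in> X \<Longrightarrow> (\<Sum>i\<in>UNIV. x i * z $ i) = 0" "y \<in> vec.span X"
  shows "(\<Sum>i\<in>UNIV. x i * y $ i) = 0"
  using assms(2)
proof (induction rule: vec.span_induct_alt)
  case (step a z z')
  then have "a * (\<Sum>i\<in>UNIV. x i * z $ i) = 0" using assms(1) by simp
  then show ?case using step.IH
    by (simp add: algebra_simps sum.distrib sum_distrib_left)
qed simp

text \<open>Linear extension gives a functional with prescribed values on an independent set. It is
  read off as one row of the matrix of an endomorphism, since the extension is taken with values in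
  \<open>'a^'n\<close>.\<close>

lemma dual_vector:
  fixes X :: "('a::field^'n::finite) set"
  assumes "vec.independent X" "x \<in> X"
  obtains c where "\<And>z. z \<in> X \<Longrightarrow> (\<Sum>j\<in>UNIV. c $ j * z $ j) = (if z = x then 1 else 0)"
proof -
  obtain g :: "'a^'n \<Rightarrow> 'a^'n" where g: "Vector_Spaces.linear (*s) (*s) g"
    "\<forall>z\<in>X. g z = (if z = x then 1 else 0)"
    using vec.linear_independent_extend[OF assms(1), of "\<lambda>z. if z = x then 1 else 0"] by metis
  have g_eq: "g z $ i = (\<Sum>j\<in>UNIV. matrix g $ i $ j * z $ j)" for z i
    using matrix_works[OF g(1), of z] by (simp add: matrix_vector_mult_def vec_eq_iff)
  \<comment> \<open>The value of \<open>g\<close> at \<open>x\<close> is the vector with all entries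
    one, so every row of the matrix has the required values; \<open>undefined\<close> merely names
    some row.\<close>
  have "(\<Sum>j\<in>UNIV. row undefined (matrix g) $ j * z $ j) = (if z = x then 1 else 0)" if "z \<in> X" for z
    using g_eq[of z undefined] g(2) that by (auto simp: row_def)
  then show ?thesis by (rule that)
qed

text \<open>Over a field the row space is the annihilator of the kernel. If \<open>x\<close> were
  outside the row space, some dual vector would vanish on all rows and take the value one on
  \<open>x\<close>; it would be a kernel vector violating the assumption.\<close>

lemma annihilator_of_kernel:
  fixes A :: "'a::field^'n^'d" and x :: "'a^'n::finite"
  assumes "\<And>y. A *v y = 0 \<Longrightarrow> (\<Sum>j\<in>UNIV. x $ j * y $ j) = 0"
  obtains \<mu> where "\<And>j. x $ j = (\<Sum>i\<in>UNIV. \<mu> i * A $ i $ j)"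
proof -
  have "x \<in> vec.span (rows A)"
  proof (rule ccontr)
    assume x: "x \<notin> vec.span (rows A)"
    obtain X where X: "X \<subseteq> rows A" "vec.independent X" "rows A \<subseteq> vec.span X"
      by (rule vec.maximal_independent_subset)
    have sp: "vec.span X = vec.span (rows A)"
      using X by (metis vec.span_eq vec.span_superset subset_trans)
    have "vec.independent (insert x X)" using x X(2) sp by (intro vec.independent_insertI) auto
    then obtain c where c: "\<And>z. z \<in> insert x X \<Longrightarrow> (\<Sum>j\<in>UNIV. c $ j * z $ j) = (if z = x then 1 else 0)"
      by (rule dual_vector) auto
    have xX: "x \<notin> X" using x sp vec.span_superset by blast
    have "(\<Sum>j\<in>UNIV. c $ j * z $ j) = 0" if "z \<in> X" for z
      using c[of z] that xX by auto
    from span_sum_zero[OF this]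
    have "(\<Sum>j\<in>UNIV. c $ j * z $ j) = 0" if "z \<in> vec.span X" for z
      using that by blast
    then have "(\<Sum>j\<in>UNIV. c $ j * row i A $ j) = 0" for i
      using X(3) by (auto simp: rows_def)
    then have "A *v c = 0"
      by (simp add: matrix_vector_mult_def vec_eq_iff row_def mult.commute)
    from assms[OF this] c[of x] show False by (simp add: mult.commute)
  qed
  moreover have "\<exists>\<mu>. \<forall>j. z $ j = (\<Sum>i\<in>UNIV. \<mu> i * A $ i $ j)" if "z \<in> vec.span (rows A)" for z
    using that
  proof (induction rule: vec.span_induct_alt)
    case base
    show ?case by (rule exI[of _ "\<lambda>_. 0"]) simp
  next
    case (step a z z')
    then obtain k \<mu> where "z = row k A" "\<forall>j. z' $ j = (\<Sum>i\<in>UNIV. \<mu> i * A $ i $ j)"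
      by (auto simp: rows_def)
    then show ?case
      \<comment> \<open>The new summand is \<open>a\<close> times row \<open>k\<close>, so only the
        coefficient at \<open>k\<close> changes.\<close>
      by (intro exI[of _ "\<lambda>i. \<mu> i + (if i = k then a else 0)"])
         (simp add: distrib_right sum.distrib if_distribR if_distrib[of "\<lambda>u. u * _"] row_def sum.delta cong: if_cong)
  qed
  ultimately show ?thesis using that by blast
qed

section \<open>Order and coefficients of formal power series\<close>

text \<open>Total degree. Summing over the support keeps the sum finite when the type of variables
  is infinite, as for the \<open>s\<close> variables indexed by \<open>nat\<close>.\<close>

definition mdeg :: "('v \<Rightarrow>\<^sub>0 nat) \<Rightarrow> nat" where
  "mdeg m = (\<Sum>i\<in>Poly_Mapping.keys m. lookup m i)"

lemma mdeg_eq_sum: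
  assumes "finite S" "Poly_Mapping.keys m \<subseteq> S"
  shows "mdeg m = (\<Sum>i\<in>S. lookup m i)"
  unfolding mdeg_def using assms by (intro sum.mono_neutral_left) (auto simp: in_keys_iff)

lemma mdeg_add: "mdeg (a + b) = mdeg a + mdeg b"
proof -
  let ?S = "Poly_Mapping.keys a \<union> Poly_Mapping.keys b"
  have "mdeg (a + b) = (\<Sum>i\<in>?S. lookup (a + b) i)" "mdeg a = (\<Sum>i\<in>?S. lookup a i)"
    "mdeg b = (\<Sum>i\<in>?S. lookup b i)"
    by (rule mdeg_eq_sum; auto simp: keys_add_nat)+
  then show ?thesis by (simp add: lookup_add sum.distrib)
qed

lemma mdeg_single [simp]: "mdeg (Poly_Mapping.single i n) = n"
  by (simp add: mdeg_def)

lemma mdeg_eq_0_iff [simp]: "mdeg m = 0 \<longleftrightarrow> m = 0"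
proof
  assume "mdeg m = 0"
  then have "lookup m i = 0" for i by (cases "i \<in> Poly_Mapping.keys m") (auto simp: mdeg_def in_keys_iff)
  then show "m = 0" by (intro poly_mapping_eqI) simp
qed (simp add: mdeg_def)

lemma mdeg_0 [simp]: "mdeg 0 = 0"
  by simp

lemma mps_ord_ge_iff: "mps_ord_ge n f \<longleftrightarrow> (\<forall>m. f m \<noteq> 0 \<longrightarrow> n \<le> mdeg m)"
proof
  assume *: "mps_ord_ge n f"
  have "n \<le> mdeg m" if "f m \<noteq> 0" for m
    unfolding mdeg_def by (rule *[unfolded mps_ord_ge_def, rule_format, OF that]) simp_all
  then show "\<forall>m. f m \<noteq> 0 \<longrightarrow> n \<le> mdeg m" by blast
next
  assume "\<forall>m. f m \<noteq> 0 \<longrightarrow> n \<le> mdeg m"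
  then show "mps_ord_ge n f" unfolding mps_ord_ge_def by (metis mdeg_eq_sum)
qed

lemma mps_ord_ge_1_iff: "mps_ord_ge 1 f \<longleftrightarrow> f 0 = 0"
  unfolding mps_ord_ge_iff by (metis One_nat_def Suc_leI mdeg_eq_0_iff gr0I not_one_le_zero)

text \<open>Index sets of truncated sums. They are finite for finite \<open>V\<close>, which allows
  coefficients of infinite combinations to be computed by ordinary finite sums.\<close>

definition exponents :: "'v set \<Rightarrow> nat \<Rightarrow> ('v \<Rightarrow>\<^sub>0 nat) set" where
  "exponents V n = {\<alpha>. Poly_Mapping.keys \<alpha> \<subseteq> V \<and> mdeg \<alpha> \<le> n}"

lemma finite_exponents:
  assumes "finite V"
  shows "finite (exponents V n)"
proof (rule finite_subset[OF subsetI finite_bounded_exponents], intro CollectI allI)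
  fix \<alpha> i assume \<alpha>: "\<alpha> \<in> exponents V n"
  have c: "lookup (\<Sum>i\<in>V. Poly_Mapping.single i n) i = (if i \<in> V then n else 0)"
    using assms by (simp add: lookup_sum lookup_single when_def)
  show "lookup \<alpha> i \<le> lookup (\<Sum>i\<in>V. Poly_Mapping.single i n) i"
  proof (cases "i \<in> Poly_Mapping.keys \<alpha>")
    case True
    then have "lookup \<alpha> i \<le> mdeg \<alpha>" unfolding mdeg_def by (intro member_le_sum) auto
    then show ?thesis using True \<alpha> unfolding c exponents_def by auto
  qed (simp add: in_keys_iff)
qed

section \<open>Coefficientwise form of the ring operations\<close>

lemma mps_uminus:
  assumes "g \<in> carrier (mps_ring V)"
  shows "\<ominus>\<^bsub>mps_ring V\<^esub> g = (\<lambda>m. - g m)"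
proof -
  interpret cring "mps_ring V" by (rule cring_mps_ring)
  show ?thesis
    by (rule minus_equality) (use assms in \<open>auto simp: mps_ring_simps\<close>)
qed

lemma mps_minus:
  assumes "g \<in> carrier (mps_ring V)"
  shows "f \<ominus>\<^bsub>mps_ring V\<^esub> g = (\<lambda>m. f m - g m)"
  using assms by (simp add: a_minus_def mps_uminus mps_ring_simps(5))

lemma mps_finsum:
  fixes F :: "'i \<Rightarrow> ('v, 'a::comm_ring_1) mps"
  assumes "\<And>i. i \<in> I \<Longrightarrow> F i \<in> carrier (mps_ring V)"
  shows "(\<Oplus>\<^bsub>mps_ring V\<^esub>i\<in>I. F i) = (\<lambda>m. \<Sum>i\<in>I. F i m)"
proof -
  interpret cring "mps_ring V :: ('v, 'a) mps ring" by (rule cring_mps_ring)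
  show ?thesis using assms
  proof (induction I rule: infinite_finite_induct)
    case (insert i I)
    have "(\<Oplus>\<^bsub>mps_ring V\<^esub>i\<in>insert i I. F i) = F i \<oplus>\<^bsub>mps_ring V\<^esub> (\<Oplus>\<^bsub>mps_ring V\<^esub>i\<in>I. F i)"
      using insert.prems insert.hyps by (intro finsum_insert) auto
    then show ?case using insert by (simp add: mps_ring_simps(5))
  qed (simp_all add: mps_ring_simps(4))
qed

lemma mps_const_mult: "mps_const c \<otimes>\<^bsub>mps_ring V\<^esub> f = (\<lambda>m. c * f m)"
proof
  fix m
  have "(mps_const c \<otimes>\<^bsub>mps_ring V\<^esub> f) m =
      (\<Sum>p\<in>{(a, b). a + b = m}. if p = (0, m) then c * f m else 0)"
    unfolding mps_ring_simps mps_const_def by (intro sum.cong) (auto split: if_splits)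
  also have "\<dots> = c * f m" by (simp add: sum.delta finite_splits)
  finally show "(mps_const c \<otimes>\<^bsub>mps_ring V\<^esub> f) m = c * f m" .
qed

lemma mps_const_closed: "mps_const c \<in> carrier (mps_ring V)"
  by (simp add: mps_ring_simps mps_const_def)

lemma mps_var_closed: "i \<in> V \<Longrightarrow> mps_var i \<in> carrier (mps_ring V)"
  by (simp add: mps_ring_simps mps_var_def)

lemma mps_linear_eq:
  "mps_linear V c = (\<lambda>m. \<Sum>k\<in>V. c k * mps_var k m)"
proof -
  interpret cring "mps_ring V :: ('a, 'b) mps ring" by (rule cring_mps_ring)
  have "mps_linear V c = (\<lambda>m. \<Sum>k\<in>V. (mps_const (c k) \<otimes>\<^bsub>mps_ring V\<^esub> mps_var k) m)"
    unfolding mps_linear_def by (intro mps_finsum m_closed mps_const_closed mps_var_closed)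
  then show ?thesis by (simp add: mps_const_mult)
qed

lemma mps_linear_closed: "mps_linear V c \<in> carrier (mps_ring V)"
proof -
  interpret cring "mps_ring V :: ('a, 'b) mps ring" by (rule cring_mps_ring)
  show ?thesis unfolding mps_linear_def
    by (auto intro!: finsum_closed m_closed mps_const_closed mps_var_closed)
qed

lemma mps_linear_0: "mps_linear V c 0 = 0"
  unfolding mps_linear_eq mps_var_def
  by (intro sum.neutral) (auto, metis mdeg_single mdeg_eq_0_iff One_nat_def zero_neq_one)

definition mps_monom :: "('v \<Rightarrow>\<^sub>0 nat) \<Rightarrow> ('v, 'a::comm_ring_1) mps" where
  "mps_monom \<alpha> = (\<lambda>m. if m = \<alpha> then 1 else 0)"

lemma mps_monom_0: "mps_monom 0 = \<one>\<^bsub>mps_ring V\<^esub>"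
  by (simp add: mps_monom_def mps_ring_simps)

lemma mps_monom_single: "mps_monom (Poly_Mapping.single i 1) = mps_var i"
  by (simp add: mps_monom_def mps_var_def)

lemma mps_monom_closed: "Poly_Mapping.keys \<alpha> \<subseteq> V \<Longrightarrow> mps_monom \<alpha> \<in> carrier (mps_ring V)"
  by (simp add: mps_monom_def mps_ring_simps)

lemma mps_monom_add: "mps_monom (\<alpha> + \<beta>) = mps_monom \<alpha> \<otimes>\<^bsub>mps_ring V\<^esub> mps_monom \<beta>"
proof
  fix m
  have "(mps_monom \<alpha> \<otimes>\<^bsub>mps_ring V\<^esub> mps_monom \<beta>) m =
      (\<Sum>p\<in>{(a, b). a + b = m}. if p = (\<alpha>, \<beta>) then 1 else 0)"
    unfolding mps_ring_simps mps_monom_def by (intro sum.cong) (auto split: if_splits)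
  also have "\<dots> = mps_monom (\<alpha> + \<beta>) m" by (auto simp: sum.delta finite_splits mps_monom_def)
  finally show "mps_monom (\<alpha> + \<beta>) m = (mps_monom \<alpha> \<otimes>\<^bsub>mps_ring V\<^esub> mps_monom \<beta>) m" ..
qed

lemma mps_ord_ge_monom: "mps_ord_ge (mdeg \<alpha>) (mps_monom \<alpha>)"
  by (simp add: mps_ord_ge_iff mps_monom_def)

section \<open>Order-preserving homomorphisms and substitution\<close>

text \<open>\<open>hom_ord_ge\<close> is continuity for the degree filtration: up to a given degree,
  the image of a series depends only on a truncation of it. \<open>hom_const\<close> makes the map
  linear over the coefficient ring.\<close>

locale mps_hom = ring_hom_cring "mps_ring V" "mps_ring W" F
  for V :: "'v set" and W :: "'w set" and F :: "('v, 'a::comm_ring_1) mps \<Rightarrow> ('w, 'a) mps" +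
  assumes hom_const: "F (mps_const c) = mps_const c"
    and hom_ord_ge: "f \<in> carrier (mps_ring V) \<Longrightarrow> mps_ord_ge n f \<Longrightarrow> mps_ord_ge n (F f)"

lemma mps_hom_comp:
  assumes "mps_hom U V F" "mps_hom V W G"
  shows "mps_hom U W (G \<circ> F)"
proof -
  interpret F: mps_hom U V F by fact
  interpret G: mps_hom V W G by fact
  have "G \<circ> F \<in> ring_hom (mps_ring U) (mps_ring W)"
    by (rule ring_hom_trans[OF F.homh G.homh])
  then show ?thesis
    by unfold_locales (simp_all add: F.hom_const G.hom_const F.hom_ord_ge G.hom_ord_ge)
qed

lemma (in mps_hom) hom_linear:
  assumes "finite V"
  shows "F (mps_linear V c) = (\<lambda>m. \<Sum>k\<in>V. c k * F (mps_var k) m)"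
proof -
  have "F (mps_linear V c) =
      (\<Oplus>\<^bsub>mps_ring W\<^esub>k\<in>V. mps_const (c k) \<otimes>\<^bsub>mps_ring W\<^esub> F (mps_var k))"
    unfolding mps_linear_def
    by (subst hom_finsum)
       (auto simp: o_def hom_const mps_const_closed mps_var_closed intro!: S.finsum_cong')
  also have "\<dots> = (\<lambda>m. \<Sum>k\<in>V. c k * F (mps_var k) m)"
    by (subst mps_finsum) (auto simp: mps_const_closed mps_var_closed mps_const_mult intro!: S.m_closed[of "mps_const _", unfolded mps_const_mult])
  finally show ?thesis .
qed

text \<open>Unlike \<^const>\<open>mps_subst\<close>, this allows the source variables \<^term>\<open>W\<close> to be a proper subset of
  an infinite type, as is needed for maps out of \<open>\<complex>[[s]]\<close>.\<close>

definition mps_eval ::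
  "'v set \<Rightarrow> 'w set \<Rightarrow> ('w \<Rightarrow> ('v, 'a) mps) \<Rightarrow> ('w, 'a) mps \<Rightarrow> ('v, 'a::comm_ring_1) mps" where
  "mps_eval V W l f = (\<lambda>m. Sum_any (\<lambda>\<alpha>.
     f \<alpha> * (\<Otimes>\<^bsub>mps_ring V\<^esub>j\<in>W. l j [^]\<^bsub>mps_ring V\<^esub> lookup \<alpha> j) m))"

lemma mps_subst_eq_eval: "mps_subst V l = mps_eval V UNIV l"
  by (simp add: fun_eq_iff mps_subst_def mps_eval_def)

section \<open>Substitution of series without constant term\<close>

context
  fixes V :: "'v set" and W :: "'w set" and l :: "'w \<Rightarrow> ('v, 'a::comm_ring_1) mps"
  assumes W: "finite W" and l: "\<And>j. l j \<in> carrier (mps_ring V)" and l0: "\<And>j. l j 0 = 0"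
begin

interpretation R: cring "mps_ring V :: ('v, 'a) mps ring" by (rule cring_mps_ring)

private definition pw :: "('w \<Rightarrow>\<^sub>0 nat) \<Rightarrow> ('v, 'a) mps" where
  "pw \<alpha> = (\<Otimes>\<^bsub>mps_ring V\<^esub>j\<in>W. l j [^]\<^bsub>mps_ring V\<^esub> lookup \<alpha> j)"

private lemma pw_closed: "pw \<alpha> \<in> carrier (mps_ring V)"
  unfolding pw_def using l by (intro R.finprod_closed) auto

private lemma pw_0: "pw 0 = \<one>\<^bsub>mps_ring V\<^esub>"
  unfolding pw_def using R.finprod_one_eqI by simp

private lemma pw_add: "pw (\<alpha> + \<beta>) = pw \<alpha> \<otimes>\<^bsub>mps_ring V\<^esub> pw \<beta>"
  unfolding pw_def using l
  by (subst R.finprod_multf[symmetric]) (auto simp: lookup_add R.nat_pow_mult)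

private lemma pw_single:
  assumes "i \<in> W"
  shows "pw (Poly_Mapping.single i 1) = l i"
proof -
  have "pw (Poly_Mapping.single i 1) =
      (\<Otimes>\<^bsub>mps_ring V\<^esub>j\<in>W. if i = j then l j else \<one>\<^bsub>mps_ring V\<^esub>)"
    unfolding pw_def using l by (intro R.finprod_cong') (auto simp: lookup_single when_def)
  also have "\<dots> = l i" by (rule R.finprod_singleton) (use assms W l in auto)
  finally show ?thesis .
qed

text \<open>Each \<open>l j\<close> has no constant term, hence order at least one, and orders add
  up in products.\<close>

private lemma pw_ord_ge:
  assumes "Poly_Mapping.keys \<alpha> \<subseteq> W"
  shows "mps_ord_ge (mdeg \<alpha>) (pw \<alpha>)"
proof -
  have "mps_ord_ge (\<Sum>j\<in>J. lookup \<alpha> j) (\<Otimes>\<^bsub>mps_ring V\<^esub>j\<in>J. l j [^]\<^bsub>mps_ring V\<^esub> lookup \<alpha> j)"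
    if "finite J" for J
    using that
  proof (induction J)
    case empty
    then show ?case by (simp add: mps_ord_ge_one)
  next
    case (insert j J)
    have "mps_ord_ge (lookup \<alpha> j) (l j [^]\<^bsub>mps_ring V\<^esub> lookup \<alpha> j)"
      by (rule mps_ord_ge_pow) (use l0 mps_ord_ge_1_iff in blast)
    from mps_ord_ge_mult[OF this insert.IH, of V] show ?case
      using insert.hyps l by (subst R.finprod_insert) auto
  qed
  from this[OF W] show ?thesis unfolding pw_def mdeg_eq_sum[OF W assms] .
qed

text \<open>Exponents of degree above \<open>mdeg m\<close> contribute nothing, by
  \<open>pw_ord_ge\<close>. The bound \<open>n\<close> is left free so that coefficients at
  different \<open>m\<close> can be written over one common index set.\<close>

private lemma eval_eq_sum:
  assumes f: "f \<in> carrier (mps_ring W)" and n: "mdeg m \<le> n"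
  shows "mps_eval V W l f m = (\<Sum>\<alpha>\<in>exponents W n. f \<alpha> * pw \<alpha> m)"
  unfolding mps_eval_def pw_def[symmetric]
proof (rule Sum_any.expand_superset[OF finite_exponents[OF W]], clarify)
  fix \<alpha> assume nz: "f \<alpha> * pw \<alpha> m \<noteq> 0"
  then have "f \<alpha> \<noteq> 0" by auto
  then have k: "Poly_Mapping.keys \<alpha> \<subseteq> W" using f by (simp add: mps_ring_simps)
  have "pw \<alpha> m \<noteq> 0" using nz by auto
  then have "mdeg \<alpha> \<le> mdeg m" using pw_ord_ge[OF k] by (simp add: mps_ord_ge_iff)
  then show "\<alpha> \<in> exponents W n" using k n by (simp add: exponents_def)
qed

private lemma eval_closed:
  assumes f: "f \<in> carrier (mps_ring W)"
  shows "mps_eval V W l f \<in> carrier (mps_ring V)"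
proof -
  have "Poly_Mapping.keys m \<subseteq> V" if nz: "mps_eval V W l f m \<noteq> 0" for m
  proof -
    obtain \<alpha> where "f \<alpha> * pw \<alpha> m \<noteq> 0"
      using nz unfolding eval_eq_sum[OF f order_refl] by (rule sum.not_neutral_contains_not_neutral)
    then have "pw \<alpha> m \<noteq> 0" by auto
    then show ?thesis using pw_closed[of \<alpha>] by (simp add: mps_ring_simps)
  qed
  then show ?thesis by (simp add: mps_ring_simps(1))
qed

private lemma eval_mult:
  assumes f: "f \<in> carrier (mps_ring W)" and g: "g \<in> carrier (mps_ring W)"
  shows "mps_eval V W l (f \<otimes>\<^bsub>mps_ring W\<^esub> g) =
    mps_eval V W l f \<otimes>\<^bsub>mps_ring V\<^esub> mps_eval V W l g"
proof
  fix m :: "'v \<Rightarrow>\<^sub>0 nat"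
  define n where "n = mdeg m"
  let ?D = "exponents W n" and ?S = "{(a, b). a + b = m}"
  have deg: "mdeg a \<le> n" "mdeg b \<le> n" if "(a, b) \<in> ?S" for a b
    using that by (auto simp: n_def mdeg_add)
  have fin: "finite ?D" by (rule finite_exponents[OF W])
  have "(mps_eval V W l f \<otimes>\<^bsub>mps_ring V\<^esub> mps_eval V W l g) m =
      (\<Sum>(a, b)\<in>?S. (\<Sum>\<alpha>\<in>?D. f \<alpha> * pw \<alpha> a) * (\<Sum>\<beta>\<in>?D. g \<beta> * pw \<beta> b))"
    unfolding mps_ring_simps(2)
    by (rule sum.cong[OF refl], clarify) (simp only: eval_eq_sum[OF f deg(1)] eval_eq_sum[OF g deg(2)] mem_Collect_eq case_prod_conv)
  also have "\<dots> = (\<Sum>p\<in>?S. \<Sum>q\<in>?D \<times> ?D. f (fst q) * g (snd q) * (pw (fst q) (fst p) * pw (snd q) (snd p)))"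
    by (simp add: sum_product sum.cartesian_product case_prod_unfold mult_ac)
  also have "\<dots> = (\<Sum>q\<in>?D \<times> ?D. \<Sum>p\<in>?S. f (fst q) * g (snd q) * (pw (fst q) (fst p) * pw (snd q) (snd p)))"
    by (rule sum.swap)
  also have "\<dots> = (\<Sum>q\<in>?D \<times> ?D. f (fst q) * g (snd q) * pw (fst q + snd q) m)"
    unfolding pw_add mps_ring_simps(2) by (simp add: sum_distrib_left case_prod_unfold)
  \<comment> \<open>Pairs whose sum leaves \<open>?D\<close> have total degree above
    \<open>mdeg m\<close> and drop out by the order bound; pairs whose sum stays in
    \<open>?D\<close> have both components in \<open>?D\<close>.\<close>
  also have "\<dots> = (\<Sum>q\<in>{q. fst q + snd q \<in> ?D}. f (fst q) * g (snd q) * pw (fst q + snd q) m)"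
  proof (rule sum.mono_neutral_right)
    show "finite (?D \<times> ?D)" using fin by simp
    show "{q. fst q + snd q \<in> ?D} \<subseteq> ?D \<times> ?D"
      by (auto simp: exponents_def mdeg_add keys_add_nat)
    show "\<forall>q\<in>?D \<times> ?D - {q. fst q + snd q \<in> ?D}. f (fst q) * g (snd q) * pw (fst q + snd q) m = 0"
    proof
      fix q assume q: "q \<in> ?D \<times> ?D - {q. fst q + snd q \<in> ?D}"
      then have k: "Poly_Mapping.keys (fst q + snd q) \<subseteq> W"
        by (auto simp: exponents_def keys_add_nat)
      with q have "\<not> mdeg (fst q + snd q) \<le> mdeg m" by (auto simp: exponents_def n_def)
      then have "pw (fst q + snd q) m = 0" using pw_ord_ge[OF k] unfolding mps_ord_ge_iff by blast
      then show "f (fst q) * g (snd q) * pw (fst q + snd q) m = 0" by simp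
    qed
  qed
  \<comment> \<open>Grouping the pairs by their sum \<open>\<gamma>\<close> recovers the
    coefficients of the product of \<open>f\<close> and \<open>g\<close>.\<close>
  also have "\<dots> = (\<Sum>(\<gamma>, q)\<in>(SIGMA \<gamma>:?D. {(a, b). a + b = \<gamma>}). f (fst q) * g (snd q) * pw \<gamma> m)"
    by (rule sum.reindex_bij_witness[where i = snd and j = "\<lambda>q. (fst q + snd q, q)"]) auto
  also have "\<dots> = (\<Sum>\<gamma>\<in>?D. \<Sum>q\<in>{(a, b). a + b = \<gamma>}. f (fst q) * g (snd q) * pw \<gamma> m)"
    using fin by (subst sum.Sigma) (simp_all add: finite_splits)
  also have "\<dots> = (\<Sum>\<gamma>\<in>?D. (f \<otimes>\<^bsub>mps_ring W\<^esub> g) \<gamma> * pw \<gamma> m)"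
    by (simp add: mps_ring_simps(2) sum_distrib_right case_prod_unfold)
  also have "\<dots> = mps_eval V W l (f \<otimes>\<^bsub>mps_ring W\<^esub> g) m"
    using mps_mult_closed[OF f g] by (subst eval_eq_sum) (auto simp: n_def)
  finally show "mps_eval V W l (f \<otimes>\<^bsub>mps_ring W\<^esub> g) m =
    (mps_eval V W l f \<otimes>\<^bsub>mps_ring V\<^esub> mps_eval V W l g) m" ..
qed

private lemma eval_const: "mps_eval V W l (mps_const c) = mps_const c"
proof
  fix m
  have "mps_eval V W l (mps_const c) m = (\<Sum>\<alpha>\<in>exponents W (mdeg m). mps_const c \<alpha> * pw \<alpha> m)"
    by (rule eval_eq_sum[OF mps_const_closed order_refl])
  also have "\<dots> = (\<Sum>\<alpha>\<in>exponents W (mdeg m). if \<alpha> = 0 then c * pw 0 m else 0)"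
    by (rule sum.cong) (auto simp: mps_const_def)
  also have "\<dots> = mps_const c m"
    by (subst sum.delta[OF finite_exponents[OF W]])
       (simp add: pw_0 mps_ring_simps mps_const_def exponents_def)
  finally show "mps_eval V W l (mps_const c) m = mps_const c m" .
qed

lemma mps_eval_var:
  assumes i: "i \<in> W"
  shows "mps_eval V W l (mps_var i) = l i"
proof
  fix m
  let ?e = "Poly_Mapping.single i (1::nat)"
  \<comment> \<open>The bound is raised by one so that \<open>?e\<close>, of degree one, is in range
    even for \<open>m = 0\<close>.\<close>
  have "mps_eval V W l (mps_var i) m = (\<Sum>\<alpha>\<in>exponents W (mdeg m + 1). mps_var i \<alpha> * pw \<alpha> m)"
    by (rule eval_eq_sum[OF mps_var_closed[OF i]]) simp
  also have "\<dots> = (\<Sum>\<alpha>\<in>exponents W (mdeg m + 1). if \<alpha> = ?e then pw ?e m else 0)"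
    by (rule sum.cong) (auto simp: mps_var_def)
  also have "\<dots> = l i m"
    using i unfolding pw_single[OF i]
    by (subst sum.delta[OF finite_exponents[OF W]]) (simp add: exponents_def)
  finally show "mps_eval V W l (mps_var i) m = l i m" .
qed

lemma mps_hom_eval: "mps_hom W V (mps_eval V W l)"
proof -
  have "mps_eval V W l \<in> ring_hom (mps_ring W) (mps_ring V)"
  proof (rule ring_hom_memI)
    fix f g :: "('w, 'a) mps" assume f: "f \<in> carrier (mps_ring W)" and g: "g \<in> carrier (mps_ring W)"
    show "mps_eval V W l f \<in> carrier (mps_ring V)" by (rule eval_closed[OF f])
    show "mps_eval V W l (f \<otimes>\<^bsub>mps_ring W\<^esub> g) = mps_eval V W l f \<otimes>\<^bsub>mps_ring V\<^esub> mps_eval V W l g"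
      by (rule eval_mult[OF f g])
    interpret C: cring "mps_ring W :: ('w, 'a) mps ring" by (rule cring_mps_ring)
    show "mps_eval V W l (f \<oplus>\<^bsub>mps_ring W\<^esub> g) = mps_eval V W l f \<oplus>\<^bsub>mps_ring V\<^esub> mps_eval V W l g"
    proof
      fix m
      show "mps_eval V W l (f \<oplus>\<^bsub>mps_ring W\<^esub> g) m = (mps_eval V W l f \<oplus>\<^bsub>mps_ring V\<^esub> mps_eval V W l g) m"
        using eval_eq_sum[OF C.add.m_closed[OF f g] order_refl, of m]
        by (simp add: mps_ring_simps(5) eval_eq_sum[OF f order_refl] eval_eq_sum[OF g order_refl]
            distrib_right sum.distrib)
    qed
  next
    show "mps_eval V W l \<one>\<^bsub>mps_ring W\<^esub> = \<one>\<^bsub>mps_ring V\<^esub>"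
      using eval_const[of 1] by (simp add: mps_const_def mps_ring_simps)
  qed
  moreover have "mps_ord_ge n (mps_eval V W l f)" if f: "f \<in> carrier (mps_ring W)" "mps_ord_ge n f" for n f
    unfolding mps_ord_ge_iff
  proof (intro allI impI)
    fix m assume "mps_eval V W l f m \<noteq> 0"
    then obtain \<alpha> where \<alpha>: "\<alpha> \<in> exponents W (mdeg m)" "f \<alpha> * pw \<alpha> m \<noteq> 0"
      unfolding eval_eq_sum[OF f(1) order_refl] by (rule sum.not_neutral_contains_not_neutral)
    then have "f \<alpha> \<noteq> 0" by auto
    with f(2) \<alpha>(1) show "n \<le> mdeg m" by (auto simp: mps_ord_ge_iff exponents_def)
  qed
  ultimately show ?thesis
    by (intro mps_hom.intro ring_hom_cring.intro cring_mps_ring ring_hom_cring_axioms.intro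
        mps_hom_axioms.intro eval_const)
qed

end

section \<open>Difference of a series and its image under an endomorphism\<close>

text \<open>
  Peeling off one variable at a time, \<open>t\<^sub>i x - E(t\<^sub>i) E(x) = (t\<^sub>i - E(t\<^sub>i)) x + E(t\<^sub>i) (x - E(x))\<close>. The order
  bound on the cofactors makes their infinite linear combination well defined in \<open>mps_hom_diff\<close>.
\<close>

lemma mps_hom_monom_diff:
  fixes V :: "'v set" and E :: "('v, 'a::comm_ring_1) mps \<Rightarrow> ('v, 'a) mps"
  assumes E: "mps_hom V V E" and V: "finite V" and \<alpha>: "Poly_Mapping.keys \<alpha> \<subseteq> V"
  shows "\<exists>h. (\<forall>j. h j \<in> carrier (mps_ring V) \<and> mps_ord_ge (mdeg \<alpha> - 1) (h j)) \<and>
    mps_monom \<alpha> \<ominus>\<^bsub>mps_ring V\<^esub> E (mps_monom \<alpha>) =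
      (\<Oplus>\<^bsub>mps_ring V\<^esub>j\<in>V. (mps_var j \<ominus>\<^bsub>mps_ring V\<^esub> E (mps_var j)) \<otimes>\<^bsub>mps_ring V\<^esub> h j)"
proof -
  interpret R: cring "mps_ring V :: ('v, 'a) mps ring" by (rule cring_mps_ring)
  interpret E: mps_hom V V E by fact
  let ?u = "\<lambda>j. mps_var j \<ominus>\<^bsub>mps_ring V\<^esub> E (mps_var j)"
  have u: "?u j \<in> carrier (mps_ring V)" if "j \<in> V" for j
    using that by (simp add: mps_var_closed)
  show ?thesis using \<alpha>
  proof (induction "mdeg \<alpha>" arbitrary: \<alpha>)
    case 0
    then have \<alpha>: "\<alpha> = 0" by simp
    have z: "(\<Oplus>\<^bsub>mps_ring V\<^esub>j\<in>V. ?u j \<otimes>\<^bsub>mps_ring V\<^esub> \<zero>\<^bsub>mps_ring V\<^esub>) = \<zero>\<^bsub>mps_ring V\<^esub>"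
      using u by (intro R.add.finprod_one_eqI) simp
    show ?case
    proof (intro exI conjI allI)
      show "mps_ord_ge (mdeg \<alpha> - 1) \<zero>\<^bsub>mps_ring V\<^esub>" by (simp add: mps_ord_ge_iff mps_ring_simps(4))
      show "mps_monom \<alpha> \<ominus>\<^bsub>mps_ring V\<^esub> E (mps_monom \<alpha>) = (\<Oplus>\<^bsub>mps_ring V\<^esub>j\<in>V. ?u j \<otimes>\<^bsub>mps_ring V\<^esub> \<zero>\<^bsub>mps_ring V\<^esub>)"
        unfolding z unfolding \<alpha> mps_monom_0[of V] by (simp add: R.r_neg R.minus_eq)
    qed simp
  next
    case (Suc n)
    then have "\<alpha> \<noteq> 0" by auto
    then obtain i where i: "i \<in> Poly_Mapping.keys \<alpha>" by (metis all_not_in_conv keys_eq_empty)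
    define \<beta> where "\<beta> = \<alpha> - Poly_Mapping.single i 1"
    have \<alpha>: "\<alpha> = Poly_Mapping.single i 1 + \<beta>"
      using i by (intro poly_mapping_eqI)
        (auto simp: \<beta>_def lookup_add lookup_minus lookup_single when_def in_keys_iff)
    have iV: "i \<in> V" and \<beta>V: "Poly_Mapping.keys \<beta> \<subseteq> V"
      using i Suc.prems unfolding \<alpha> by (auto simp: keys_add_nat)
    have n: "n = mdeg \<beta>" using Suc.hyps(2) unfolding \<alpha> by (simp add: mdeg_add)
    obtain h where h: "\<And>j. h j \<in> carrier (mps_ring V)" "\<And>j. mps_ord_ge (n - 1) (h j)"
      and eq: "mps_monom \<beta> \<ominus>\<^bsub>mps_ring V\<^esub> E (mps_monom \<beta>) =
        (\<Oplus>\<^bsub>mps_ring V\<^esub>j\<in>V. ?u j \<otimes>\<^bsub>mps_ring V\<^esub> h j)"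
      using Suc.hyps(1)[OF n \<beta>V] unfolding n by blast
    let ?X = "mps_monom \<beta> :: ('v, 'a) mps" and ?x = "mps_var i :: ('v, 'a) mps"
    have X: "?X \<in> carrier (mps_ring V)" "E ?X \<in> carrier (mps_ring V)"
      and x: "?x \<in> carrier (mps_ring V)" "E ?x \<in> carrier (mps_ring V)"
      using mps_monom_closed[OF \<beta>V] mps_var_closed[OF iV] by auto
    have Ex: "mps_ord_ge 1 (E ?x)"
      using mps_ord_ge_monom[of "Poly_Mapping.single i 1"]
      by (intro E.hom_ord_ge x(1)) (simp add: mps_monom_single[symmetric])
    \<comment> \<open>The cofactors given by the peeling identity: the factor \<open>?u i\<close>
      contributes \<open>?X\<close> at index \<open>i\<close>, and the inductive cofactors are
      multiplied by \<open>E ?x\<close>.\<close>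
    define k where "k = (\<lambda>j. (if i = j then ?X else \<zero>\<^bsub>mps_ring V\<^esub>) \<oplus>\<^bsub>mps_ring V\<^esub> E ?x \<otimes>\<^bsub>mps_ring V\<^esub> h j)"
    have "(\<Oplus>\<^bsub>mps_ring V\<^esub>j\<in>V. ?u j \<otimes>\<^bsub>mps_ring V\<^esub> k j) =
      (\<Oplus>\<^bsub>mps_ring V\<^esub>j\<in>V. (if i = j then ?u j \<otimes>\<^bsub>mps_ring V\<^esub> ?X else \<zero>\<^bsub>mps_ring V\<^esub>) \<oplus>\<^bsub>mps_ring V\<^esub>
         E ?x \<otimes>\<^bsub>mps_ring V\<^esub> (?u j \<otimes>\<^bsub>mps_ring V\<^esub> h j))"
      unfolding k_def using u X x h(1)
      by (intro R.finsum_cong') (auto simp: R.r_distr R.m_lcomm)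
    also have "\<dots> = (\<Oplus>\<^bsub>mps_ring V\<^esub>j\<in>V. (if i = j then ?u j \<otimes>\<^bsub>mps_ring V\<^esub> ?X else \<zero>\<^bsub>mps_ring V\<^esub>)) \<oplus>\<^bsub>mps_ring V\<^esub>
        (\<Oplus>\<^bsub>mps_ring V\<^esub>j\<in>V. E ?x \<otimes>\<^bsub>mps_ring V\<^esub> (?u j \<otimes>\<^bsub>mps_ring V\<^esub> h j))"
      using u X x h(1) by (intro R.finsum_addf) auto
    also have "\<dots> = ?u i \<otimes>\<^bsub>mps_ring V\<^esub> ?X \<oplus>\<^bsub>mps_ring V\<^esub>
        E ?x \<otimes>\<^bsub>mps_ring V\<^esub> (\<Oplus>\<^bsub>mps_ring V\<^esub>j\<in>V. ?u j \<otimes>\<^bsub>mps_ring V\<^esub> h j)"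
      using u X x h(1) V iV
      by (subst R.finsum_rdistr, simp, simp, blast intro: R.m_closed, subst R.add.finprod_singleton) auto
    also have "\<dots> = (?x \<ominus>\<^bsub>mps_ring V\<^esub> E ?x) \<otimes>\<^bsub>mps_ring V\<^esub> ?X \<oplus>\<^bsub>mps_ring V\<^esub>
        E ?x \<otimes>\<^bsub>mps_ring V\<^esub> (?X \<ominus>\<^bsub>mps_ring V\<^esub> E ?X)"
      unfolding eq ..
    also have "\<dots> = ?x \<otimes>\<^bsub>mps_ring V\<^esub> ?X \<ominus>\<^bsub>mps_ring V\<^esub> E ?x \<otimes>\<^bsub>mps_ring V\<^esub> E ?X"
      using X x by algebra
    also have "\<dots> = mps_monom \<alpha> \<ominus>\<^bsub>mps_ring V\<^esub> E (mps_monom \<alpha>)"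
      using X x unfolding \<alpha> mps_monom_add[of _ _ V] mps_monom_single by simp
    finally have k_eq: "mps_monom \<alpha> \<ominus>\<^bsub>mps_ring V\<^esub> E (mps_monom \<alpha>) =
      (\<Oplus>\<^bsub>mps_ring V\<^esub>j\<in>V. ?u j \<otimes>\<^bsub>mps_ring V\<^esub> k j)" ..
    have k: "k j \<in> carrier (mps_ring V)" for j
      unfolding k_def using X x h(1) by auto
    have "mps_ord_ge n (k j)" for j
    proof -
      \<comment> \<open>The factor \<open>E ?x\<close> raises the order by one. The subtraction is
        truncated: \<open>1 + (n - 1)\<close> is \<open>n\<close> for positive \<open>n\<close> and
        \<open>1\<close> for \<open>n = 0\<close>, hence at least \<open>n\<close> in both
        cases.\<close>
      have 1: "mps_ord_ge (1 + (n - 1)) (E ?x \<otimes>\<^bsub>mps_ring V\<^esub> h j)"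
        by (rule mps_ord_ge_mult[OF Ex h(2)])
      have 2: "mps_ord_ge n ?X" unfolding n by (rule mps_ord_ge_monom)
      show ?thesis unfolding mps_ord_ge_iff
      proof (intro allI impI)
        fix m assume "k j m \<noteq> 0"
        then have "?X m \<noteq> 0 \<or> (E ?x \<otimes>\<^bsub>mps_ring V\<^esub> h j) m \<noteq> 0"
          by (auto simp: k_def mps_ring_simps(4,5) split: if_splits)
        then have "n \<le> mdeg m \<or> 1 + (n - 1) \<le> mdeg m" using 1 2 unfolding mps_ord_ge_iff by blast
        then show "n \<le> mdeg m" by linarith
      qed
    qed
    then have "mps_ord_ge (mdeg \<alpha> - 1) (k j)" for j using Suc.hyps(2)[symmetric] by simp
    then show ?case using k k_eq by blast
  qed
qed

lemma mps_hom_diff: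
  fixes V :: "'v set" and E :: "('v, 'a::comm_ring_1) mps \<Rightarrow> ('v, 'a) mps"
  assumes E: "mps_hom V V E" and V: "finite V" and f: "f \<in> carrier (mps_ring V)"
  shows "\<exists>h. (\<forall>j. h j \<in> carrier (mps_ring V)) \<and> f \<ominus>\<^bsub>mps_ring V\<^esub> E f =
      (\<Oplus>\<^bsub>mps_ring V\<^esub>j\<in>V. (mps_var j \<ominus>\<^bsub>mps_ring V\<^esub> E (mps_var j)) \<otimes>\<^bsub>mps_ring V\<^esub> h j)"
proof -
  interpret R: cring "mps_ring V :: ('v, 'a) mps ring" by (rule cring_mps_ring)
  interpret E: mps_hom V V E by fact
  let ?X = "mps_monom :: _ \<Rightarrow> ('v, 'a) mps"
  let ?u = "\<lambda>j. mps_var j \<ominus>\<^bsub>mps_ring V\<^esub> E (mps_var j)"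
  have u: "?u j \<in> carrier (mps_ring V)" if "j \<in> V" for j
    using that by (simp add: mps_var_closed)
  have "\<forall>\<alpha>\<in>{\<alpha>. Poly_Mapping.keys \<alpha> \<subseteq> V}. \<exists>h. (\<forall>j. h j \<in> carrier (mps_ring V) \<and> mps_ord_ge (mdeg \<alpha> - 1) (h j)) \<and>
    ?X \<alpha> \<ominus>\<^bsub>mps_ring V\<^esub> E (?X \<alpha>) = (\<Oplus>\<^bsub>mps_ring V\<^esub>j\<in>V. ?u j \<otimes>\<^bsub>mps_ring V\<^esub> h j)"
    by (intro ballI mps_hom_monom_diff[OF E V]) simp
  from bchoice[OF this] obtain h where H:
    "\<forall>\<alpha>\<in>{\<alpha>. Poly_Mapping.keys \<alpha> \<subseteq> V}. (\<forall>j. h \<alpha> j \<in> carrier (mps_ring V) \<and> mps_ord_ge (mdeg \<alpha> - 1) (h \<alpha> j)) \<and>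
    ?X \<alpha> \<ominus>\<^bsub>mps_ring V\<^esub> E (?X \<alpha>) = (\<Oplus>\<^bsub>mps_ring V\<^esub>j\<in>V. ?u j \<otimes>\<^bsub>mps_ring V\<^esub> h \<alpha> j)" ..
  have h: "h \<alpha> j \<in> carrier (mps_ring V)" "mps_ord_ge (mdeg \<alpha> - 1) (h \<alpha> j)"
    and h_eq: "?X \<alpha> \<ominus>\<^bsub>mps_ring V\<^esub> E (?X \<alpha>) = (\<Oplus>\<^bsub>mps_ring V\<^esub>j\<in>V. ?u j \<otimes>\<^bsub>mps_ring V\<^esub> h \<alpha> j)"
    if "Poly_Mapping.keys \<alpha> \<subseteq> V" for \<alpha> j
    using bspec[OF H, of \<alpha>] that by simp_all
  \<comment> \<open>The infinite combination of the cofactors with coefficients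
    \<open>f \<alpha>\<close>. As \<open>h \<alpha> j\<close> has order at least
    \<open>mdeg \<alpha> - 1\<close>, only exponents of degree at most \<open>mdeg m + 1\<close>
    reach the coefficient at \<open>m\<close>.\<close>
  define k where "k = (\<lambda>j m. \<Sum>\<alpha>\<in>exponents V (mdeg m + 1). f \<alpha> * h \<alpha> j m)"
  have k_eq: "k j m = (\<Sum>\<alpha>\<in>exponents V n. f \<alpha> * h \<alpha> j m)" if "mdeg m + 1 \<le> n" for j m n
    unfolding k_def
  proof (rule sum.mono_neutral_left[OF finite_exponents[OF V]])
    show "exponents V (mdeg m + 1) \<subseteq> exponents V n" using that by (auto simp: exponents_def)
    show "\<forall>\<alpha>\<in>exponents V n - exponents V (mdeg m + 1). f \<alpha> * h \<alpha> j m = 0"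
    proof
      fix \<alpha> assume "\<alpha> \<in> exponents V n - exponents V (mdeg m + 1)"
      then have "Poly_Mapping.keys \<alpha> \<subseteq> V" "\<not> mdeg \<alpha> - 1 \<le> mdeg m" by (auto simp: exponents_def)
      then have "h \<alpha> j m = 0" using h(2) unfolding mps_ord_ge_iff by blast
      then show "f \<alpha> * h \<alpha> j m = 0" by simp
    qed
  qed
  have k: "k j \<in> carrier (mps_ring V)" for j
  proof -
    have "Poly_Mapping.keys m \<subseteq> V" if nz: "k j m \<noteq> 0" for m
    proof -
      obtain \<alpha> where \<alpha>: "\<alpha> \<in> exponents V (mdeg m + 1)" "f \<alpha> * h \<alpha> j m \<noteq> 0"
        using nz unfolding k_def by (rule sum.not_neutral_contains_not_neutral)
      then have "h \<alpha> j m \<noteq> 0" by auto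
      then show ?thesis using h(1)[of \<alpha> j] \<alpha>(1) by (simp add: mps_ring_simps(1) exponents_def)
    qed
    then show ?thesis by (simp add: mps_ring_simps(1))
  qed
  have "(f \<ominus>\<^bsub>mps_ring V\<^esub> E f) m = (\<Oplus>\<^bsub>mps_ring V\<^esub>j\<in>V. ?u j \<otimes>\<^bsub>mps_ring V\<^esub> k j) m" for m
  proof -
    let ?D = "exponents V (mdeg m + 1)" and ?S = "{(a, b). a + b = m}"
    have D: "Poly_Mapping.keys \<alpha> \<subseteq> V" if "\<alpha> \<in> ?D" for \<alpha> using that by (simp add: exponents_def)
    \<comment> \<open>The truncation of \<open>f\<close> to degree at most
      \<open>mdeg m + 1\<close>. Being a finite sum, it is mapped termwise by \<open>E\<close>,
      while the remainder and its image have zero coefficient at \<open>m\<close>.\<close>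
    define g where "g = (\<Oplus>\<^bsub>mps_ring V\<^esub>\<alpha>\<in>?D. mps_const (f \<alpha>) \<otimes>\<^bsub>mps_ring V\<^esub> ?X \<alpha>)"
    have c: "mps_const (f \<alpha>) \<otimes>\<^bsub>mps_ring V\<^esub> ?X \<alpha> \<in> carrier (mps_ring V)" if "\<alpha> \<in> ?D" for \<alpha>
      using D[OF that] by (intro R.m_closed mps_const_closed mps_monom_closed)
    have c': "mps_const (f \<alpha>) \<otimes>\<^bsub>mps_ring V\<^esub> E (?X \<alpha>) \<in> carrier (mps_ring V)" if "\<alpha> \<in> ?D" for \<alpha>
      using D[OF that] by (intro R.m_closed mps_const_closed E.hom_closed mps_monom_closed)
    have g: "g \<in> carrier (mps_ring V)" unfolding g_def using c by (intro R.finsum_closed) auto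
    have "E g = (\<Oplus>\<^bsub>mps_ring V\<^esub>\<alpha>\<in>?D. mps_const (f \<alpha>) \<otimes>\<^bsub>mps_ring V\<^esub> E (?X \<alpha>))"
      unfolding g_def using c c' D
      by (subst E.hom_finsum)
         (auto simp: mps_const_closed mps_monom_closed E.hom_const intro!: R.finsum_cong' simp del: mps_ring_simps)
    then have Eg: "E g = (\<lambda>m. \<Sum>\<alpha>\<in>?D. f \<alpha> * E (?X \<alpha>) m)"
      using mps_finsum[of ?D "\<lambda>\<alpha>. mps_const (f \<alpha>) \<otimes>\<^bsub>mps_ring V\<^esub> E (?X \<alpha>)", OF c']
      by (simp add: mps_const_mult)
    have g_eq: "g = (\<lambda>m. \<Sum>\<alpha>\<in>?D. f \<alpha> * ?X \<alpha> m)"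
      unfolding g_def using mps_finsum[of ?D "\<lambda>\<alpha>. mps_const (f \<alpha>) \<otimes>\<^bsub>mps_ring V\<^esub> ?X \<alpha>", OF c]
      by (simp add: mps_const_mult)
    have g_coeff: "g m' = (if m' \<in> ?D then f m' else 0)" for m'
    proof -
      have "g m' = (\<Sum>\<alpha>\<in>?D. if \<alpha> = m' then f m' else 0)"
        unfolding g_eq by (intro sum.cong) (auto simp: mps_monom_def)
      then show ?thesis by (simp add: finite_exponents[OF V])
    qed
    have fg: "f \<ominus>\<^bsub>mps_ring V\<^esub> g \<in> carrier (mps_ring V)" using f g by simp
    have "mps_ord_ge (mdeg m + 1) (f \<ominus>\<^bsub>mps_ring V\<^esub> g)"
      using f by (auto simp: mps_ord_ge_iff mps_minus[OF g] g_coeff exponents_def mps_ring_simps(1) split: if_splits)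
    then have "mps_ord_ge (mdeg m + 1) (E (f \<ominus>\<^bsub>mps_ring V\<^esub> g))" by (rule E.hom_ord_ge[OF fg])
    then have "E (f \<ominus>\<^bsub>mps_ring V\<^esub> g) m = 0" unfolding mps_ord_ge_iff by (metis Suc_eq_plus1 not_less_eq_eq order_refl)
    moreover have "E (f \<ominus>\<^bsub>mps_ring V\<^esub> g) = E f \<ominus>\<^bsub>mps_ring V\<^esub> E g"
      using f g by (simp add: R.minus_eq)
    ultimately have "E f m = E g m" using g by (simp add: mps_minus)
    moreover have "f m = g m" using f by (auto simp: g_coeff exponents_def mps_ring_simps(1))
    ultimately have "(f \<ominus>\<^bsub>mps_ring V\<^esub> E f) m = g m - E g m" using f by (simp add: mps_minus)
    also have "\<dots> = (\<Sum>\<alpha>\<in>?D. f \<alpha> * (?X \<alpha> \<ominus>\<^bsub>mps_ring V\<^esub> E (?X \<alpha>)) m)"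
      unfolding Eg fun_cong[OF g_eq, of m] sum_subtractf[symmetric]
      by (intro sum.cong) (simp_all add: mps_minus[OF E.hom_closed] mps_monom_closed D right_diff_distrib)
    also have "\<dots> = (\<Sum>\<alpha>\<in>?D. f \<alpha> * (\<Sum>j\<in>V. (?u j \<otimes>\<^bsub>mps_ring V\<^esub> h \<alpha> j) m))"
    proof (intro sum.cong refl)
      fix \<alpha> assume \<alpha>: "\<alpha> \<in> ?D"
      have "?u j \<otimes>\<^bsub>mps_ring V\<^esub> h \<alpha> j \<in> carrier (mps_ring V)" if "j \<in> V" for j
        using u[OF that] h(1)[OF D[OF \<alpha>]] by simp
      from mps_finsum[of V, OF this]
      show "f \<alpha> * (?X \<alpha> \<ominus>\<^bsub>mps_ring V\<^esub> E (?X \<alpha>)) m = f \<alpha> * (\<Sum>j\<in>V. (?u j \<otimes>\<^bsub>mps_ring V\<^esub> h \<alpha> j) m)"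
        unfolding h_eq[OF D[OF \<alpha>]] by simp
    qed
    also have "\<dots> = (\<Sum>j\<in>V. \<Sum>\<alpha>\<in>?D. \<Sum>(a, b)\<in>?S. ?u j a * (f \<alpha> * h \<alpha> j b))"
      unfolding sum_distrib_left mps_ring_simps(2)
      by (subst sum.swap) (simp add: case_prod_unfold mult_ac)
    also have "\<dots> = (\<Sum>j\<in>V. \<Sum>(a, b)\<in>?S. ?u j a * (\<Sum>\<alpha>\<in>?D. f \<alpha> * h \<alpha> j b))"
      by (subst sum.swap) (simp add: case_prod_unfold sum_distrib_left)
    \<comment> \<open>For a splitting \<open>a + b = m\<close> the degree of \<open>b\<close> is at
      most that of \<open>m\<close>, so the common range \<open>?D\<close> suffices for the
      coefficient of \<open>k j\<close> at \<open>b\<close>.\<close>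
    also have "\<dots> = (\<Sum>j\<in>V. \<Sum>(a, b)\<in>?S. ?u j a * k j b)"
    proof -
      have "(\<Sum>\<alpha>\<in>?D. f \<alpha> * h \<alpha> j (snd p)) = k j (snd p)" if "p \<in> {p. fst p + snd p = m}" for p j
        using that by (intro k_eq[symmetric]) (auto simp: mdeg_add)
      then show ?thesis
        unfolding case_prod_unfold by (intro sum.cong refl arg_cong2[where f = "(*)"])
    qed
    also have "\<dots> = (\<Sum>j\<in>V. (?u j \<otimes>\<^bsub>mps_ring V\<^esub> k j) m)" by (simp only: mps_ring_simps(2))
    also have "\<dots> = (\<Oplus>\<^bsub>mps_ring V\<^esub>j\<in>V. ?u j \<otimes>\<^bsub>mps_ring V\<^esub> k j) m"
    proof -
      have "?u j \<otimes>\<^bsub>mps_ring V\<^esub> k j \<in> carrier (mps_ring V)" if "j \<in> V" for j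
        using u[OF that] k by simp
      from mps_finsum[of V, OF this] show ?thesis by simp
    qed
    finally show ?thesis .
  qed
  then have "f \<ominus>\<^bsub>mps_ring V\<^esub> E f = (\<Oplus>\<^bsub>mps_ring V\<^esub>j\<in>V. ?u j \<otimes>\<^bsub>mps_ring V\<^esub> k j)" by blast
  with k show ?thesis by (intro exI[of _ k] conjI allI)
qed

text \<open>The infinitely many monomials of \<open>f\<close> have been absorbed into finitely many
  cofactors, one for each variable. This matters because an ideal is closed only under finite sums
  by definition.\<close>

lemma mps_hom_diff_in_ideal:
  fixes V :: "'v set" and E :: "('v, 'a::comm_ring_1) mps \<Rightarrow> ('v, 'a) mps"
  assumes E: "mps_hom V V E" and V: "finite V" and K: "ideal K (mps_ring V)"
    and var: "\<And>j. j \<in> V \<Longrightarrow> mps_var j \<ominus>\<^bsub>mps_ring V\<^esub> E (mps_var j) \<in> K"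
    and f: "f \<in> carrier (mps_ring V)"
  shows "f \<ominus>\<^bsub>mps_ring V\<^esub> E f \<in> K"
proof -
  interpret K: ideal K "mps_ring V" by fact
  obtain h where h: "\<And>j. h j \<in> carrier (mps_ring V)" and
    eq: "f \<ominus>\<^bsub>mps_ring V\<^esub> E f =
      (\<Oplus>\<^bsub>mps_ring V\<^esub>j\<in>V. (mps_var j \<ominus>\<^bsub>mps_ring V\<^esub> E (mps_var j)) \<otimes>\<^bsub>mps_ring V\<^esub> h j)"
    using mps_hom_diff[OF E V f] by blast
  have "(\<Oplus>\<^bsub>mps_ring V\<^esub>j\<in>J. g j) \<in> K" if "finite J" "\<And>j. j \<in> J \<Longrightarrow> g j \<in> K" for g and J :: "'v set"
    using that
  proof (induction J)
    case (insert j J)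
    then show ?case by (subst K.finsum_insert) (auto intro: K.Icarr)
  qed simp
  from this[OF V, OF K.I_r_closed[OF var h]] show ?thesis unfolding eq by simp
qed

section \<open>Kernel and image of \<open>\<Phi>\<close>\<close>

lemma Phi_hom: "mps_hom UNIV {..<r} (Phi r b)"
  unfolding Phi_def mps_subst_eq_eval
  by (rule mps_hom_eval) (simp_all add: Bs_def mps_linear_closed mps_linear_0)

lemma Phi_var: "Phi r b (mps_var j) = Bs r b j"
  unfolding Phi_def mps_subst_eq_eval
  by (rule mps_eval_var) (simp_all add: Bs_def mps_linear_closed mps_linear_0)

text \<open>On coefficient vectors of linear forms \<Phi> acts as the transpose of \<open>B\<close>.
  In particular the rows of \<open>A\<close> go to the rows of \<open>A B\<close>.\<close>

lemma Phi_linear: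
  "Phi r b (mps_linear UNIV x) = mps_linear {..<r} (\<lambda>k. \<Sum>j\<in>UNIV. x j * b k $ j)"
proof -
  interpret P: mps_hom UNIV "{..<r}" "Phi r b" by (rule Phi_hom)
  have "Phi r b (mps_linear UNIV x) = (\<lambda>m. \<Sum>j\<in>UNIV. x j * Bs r b j m)"
    by (subst P.hom_linear) (simp_all add: Phi_var)
  also have "\<dots> = mps_linear {..<r} (\<lambda>k. \<Sum>j\<in>UNIV. x j * b k $ j)"
    by (simp add: Bs_def mps_linear_eq sum_distrib_left sum_distrib_right mult.assoc sum.swap[of _ UNIV])
  finally show ?thesis .
qed

lemma At_generators_closed:
  "range (\<lambda>i. mps_linear UNIV (\<lambda>j. of_int (A $ i $ j))) \<subseteq> carrier t_ring"
  using mps_linear_closed by blast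

lemma At_ideal_ideal:
  fixes A :: "int^'n::finite^'d::finite"
  shows "ideal (At_ideal A) t_ring"
proof -
  interpret cring "t_ring :: ('n, complex) mps ring" by (rule cring_mps_ring)
  show ?thesis unfolding At_ideal_def by (rule genideal_ideal[OF At_generators_closed])
qed

text \<open>The assumption places \<open>x\<close> in the row space of \<open>A\<close>, so the form
  is a combination of the generators with constant coefficients \<open>\<mu> i\<close>.\<close>

lemma linear_in_At_ideal:
  fixes A :: "int^'n::finite^'d::finite"
  assumes x: "\<And>j. x j = (\<Sum>i\<in>UNIV. \<mu> i * of_int (A $ i $ j))"
  shows "mps_linear UNIV x \<in> At_ideal A"
proof -
  interpret cring "t_ring :: ('n, complex) mps ring" by (rule cring_mps_ring)
  interpret K: ideal "At_ideal A" t_ring by (rule At_ideal_ideal)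
  let ?l = "\<lambda>i. mps_linear UNIV (\<lambda>j. complex_of_int (A $ i $ j))"
  have l: "mps_const (\<mu> i) \<otimes>\<^bsub>t_ring\<^esub> ?l i \<in> At_ideal A" for i
    by (rule K.I_l_closed)
       (use genideal_self[OF At_generators_closed] in \<open>auto simp: At_ideal_def mps_const_closed\<close>)
  have "(\<Oplus>\<^bsub>t_ring\<^esub>i\<in>I. mps_const (\<mu> i) \<otimes>\<^bsub>t_ring\<^esub> ?l i) \<in> At_ideal A" if "finite I" for I
    using that
  proof (induction I)
    case (insert i I)
    then show ?case using l by (subst finsum_insert) (auto intro: K.Icarr)
  qed simp
  from this[of UNIV] have "(\<Oplus>\<^bsub>t_ring\<^esub>i\<in>UNIV. mps_const (\<mu> i) \<otimes>\<^bsub>t_ring\<^esub> ?l i) \<in> At_ideal A" by simp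
  also have "(\<Oplus>\<^bsub>t_ring\<^esub>i\<in>UNIV. mps_const (\<mu> i) \<otimes>\<^bsub>t_ring\<^esub> ?l i) = mps_linear UNIV x"
  proof (subst mps_finsum, rule K.Icarr[OF l], rule ext)
    fix m
    have "(\<Sum>i\<in>UNIV. (mps_const (\<mu> i) \<otimes>\<^bsub>t_ring\<^esub> ?l i) m) =
        (\<Sum>i\<in>UNIV. \<Sum>j\<in>UNIV. \<mu> i * of_int (A $ i $ j) * mps_var j m)"
      by (simp add: mps_const_mult mps_linear_eq sum_distrib_left mult.assoc)
    also have "\<dots> = mps_linear UNIV x m"
      by (subst sum.swap) (simp add: mps_linear_eq x sum_distrib_right)
    finally show "(\<Sum>i\<in>UNIV. (mps_const (\<mu> i) \<otimes>\<^bsub>t_ring\<^esub> ?l i) m) = mps_linear UNIV x m" .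
  qed
  finally show ?thesis .
qed

lemma mem_complex_kernel_iff:
  "v \<in> complex_kernel A \<longleftrightarrow> (\<forall>i. (\<Sum>j\<in>UNIV. of_int (A $ i $ j) * v $ j) = 0)"
  by (simp add: complex_kernel_def matrix_vector_mult_def vec_eq_iff map_matrix_def)

lemma Phi_surj_kernel:
  fixes A :: "int^'n::finite^'d::finite"
  assumes basis: "is_basis_of r b (complex_kernel A)"
  shows "Phi r b ` carrier t_ring = carrier (s_ring r)"
    and "a_kernel t_ring (s_ring r) (Phi r b) = At_ideal A"
proof -
  interpret s: cring "s_ring r :: (nat, complex) mps ring" by (rule cring_mps_ring)
  interpret t: cring "t_ring :: ('n, complex) mps ring" by (rule cring_mps_ring)
  interpret P: mps_hom UNIV "{..<r}" "Phi r b" by (rule Phi_hom)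
  have inj: "inj_on b {..<r}" and ind: "vec.independent (b ` {..<r})"
    and span: "vec.span (b ` {..<r}) = complex_kernel A"
    using basis by (auto simp: is_basis_of_def)
  \<comment> \<open>Dual vectors to the columns of \<open>B\<close> form the rows of a left inverse
    \<open>C\<close>. Injectivity of \<open>b\<close> turns equality of columns into equality of
    indices.\<close>
  have "\<exists>c. \<forall>l<r. (\<Sum>j\<in>UNIV. c $ j * b l $ j) = (if l = k then 1 else 0)" if k: "k < r" for k
  proof -
    obtain c where c: "\<And>z. z \<in> b ` {..<r} \<Longrightarrow> (\<Sum>j\<in>UNIV. c $ j * z $ j) = (if z = b k then 1 else 0)"
      using dual_vector[OF ind, of "b k"] k by blast
    have "(\<Sum>j\<in>UNIV. c $ j * b l $ j) = (if l = k then 1 else 0)" if "l < r" for l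
      using c[of "b l"] that k inj_onD[OF inj, of l k] by auto
    then show ?thesis by blast
  qed
  then have "\<forall>k\<in>{..<r}. \<exists>c. \<forall>l<r. (\<Sum>j\<in>UNIV. c $ j * b l $ j) = (if l = k then 1 else 0)" by simp
  from bchoice[OF this] obtain c where
    c: "\<And>k l. k < r \<Longrightarrow> l < r \<Longrightarrow> (\<Sum>j\<in>UNIV. c k $ j * b l $ j) = (if l = k then 1 else 0)"
    by (metis lessThan_iff)
  define \<sigma> where "\<sigma> = mps_eval (UNIV :: 'n set) {..<r} (\<lambda>k. mps_linear UNIV (\<lambda>j. c k $ j))"
  have \<sigma>: "mps_hom {..<r} UNIV \<sigma>"
    unfolding \<sigma>_def by (rule mps_hom_eval) (simp_all add: mps_linear_closed mps_linear_0)
  have \<sigma>_var: "\<sigma> (mps_var k) = mps_linear UNIV (\<lambda>j. c k $ j)" if "k < r" for k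
    unfolding \<sigma>_def by (rule mps_eval_var) (simp_all add: that mps_linear_closed mps_linear_0)
  interpret S: mps_hom "{..<r}" UNIV \<sigma> by (rule \<sigma>)
  have "Phi r b (\<sigma> f) = f" if f: "f \<in> carrier (s_ring r)" for f
  proof -
    have "Phi r b (\<sigma> (mps_var k)) = mps_var k" if k: "k < r" for k
    proof -
      have "Phi r b (\<sigma> (mps_var k)) = mps_linear {..<r} (\<lambda>l. if l = k then 1 else 0)"
        unfolding \<sigma>_var[OF k] Phi_linear using c[OF k] by (simp add: mps_linear_eq)
      also have "\<dots> = mps_var k"
        using k by (simp add: mps_linear_eq if_distrib[of "\<lambda>u. u * _"] sum.delta cong: if_cong)
      finally show ?thesis .
    qed
    \<comment> \<open>With the zero ideal, the difference lemma says that an endomorphism fixing all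
      variables is the identity.\<close>
    then have "mps_var k \<ominus>\<^bsub>s_ring r\<^esub> (Phi r b \<circ> \<sigma>) (mps_var k) \<in> {\<zero>\<^bsub>s_ring r\<^esub>}" if "k \<in> {..<r}" for k
      using that s.r_neg[OF mps_var_closed[OF that]] by (simp add: s.minus_eq)
    from mps_hom_diff_in_ideal[OF mps_hom_comp[OF \<sigma> Phi_hom] _ s.zeroideal this f]
    have "f \<ominus>\<^bsub>s_ring r\<^esub> Phi r b (\<sigma> f) = \<zero>\<^bsub>s_ring r\<^esub>" by simp
    then show ?thesis using f by (simp add: mps_minus mps_ring_simps(4) fun_eq_iff)
  qed
  then show "Phi r b ` carrier t_ring = carrier (s_ring r)"
    by (metis P.hom_closed S.hom_closed image_eqI image_subsetI subsetI subset_antisym)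
  have bk: "b k \<in> complex_kernel A" if "k < r" for k
    using that span vec.span_superset[of "b ` {..<r}"] by auto
  show "a_kernel t_ring (s_ring r) (Phi r b) = At_ideal A"
  proof (intro equalityI subsetI)
    fix f assume "f \<in> a_kernel t_ring (s_ring r) (Phi r b)"
    then have f: "f \<in> carrier t_ring" "Phi r b f = \<zero>\<^bsub>s_ring r\<^esub>" unfolding a_kernel_def' by simp_all
    have "mps_var j \<ominus>\<^bsub>t_ring\<^esub> (\<sigma> \<circ> Phi r b) (mps_var j) \<in> At_ideal A" for j
    proof -
      \<comment> \<open>Row \<open>j\<close> of the identity matrix minus \<open>B C\<close>; these
        are the coefficients of the difference of \<open>mps_var j\<close> and its image under
        \<open>\<sigma> \<circ> Phi r b\<close>.\<close>
      define x where "x = (\<lambda>i. (if i = j then 1 else 0) - (\<Sum>k<r. b k $ j * c k $ i))"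
      have "\<sigma> (Phi r b (mps_var j)) = (\<lambda>m. \<Sum>k<r. b k $ j * \<sigma> (mps_var k) m)"
        unfolding Phi_var Bs_def by (rule S.hom_linear) simp
      also have "\<dots> = (\<lambda>m. \<Sum>i\<in>UNIV. (\<Sum>k<r. b k $ j * c k $ i) * mps_var i m)"
        by (simp add: \<sigma>_var mps_linear_eq sum_distrib_left sum_distrib_right mult.assoc sum.swap[of _ UNIV])
      finally have eq: "\<sigma> (Phi r b (mps_var j)) =
        (\<lambda>m. \<Sum>i\<in>UNIV. (\<Sum>k<r. b k $ j * c k $ i) * mps_var i m)" .
      have "\<sigma> (Phi r b (mps_var j)) \<in> carrier t_ring" by (simp add: mps_var_closed)
      then have "mps_var j \<ominus>\<^bsub>t_ring\<^esub> (\<sigma> \<circ> Phi r b) (mps_var j) = mps_linear UNIV x"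
        unfolding o_def by (subst mps_minus, assumption, unfold eq)
          (simp add: x_def mps_linear_eq left_diff_distrib sum_subtractf
            if_distrib[of "\<lambda>u. u * _"] sum.delta cong: if_cong)
      \<comment> \<open>Since \<open>C B = 1\<close>, the vector \<open>x\<close> pairs to zero with
        each column of \<open>B\<close>, hence with the whole kernel of \<open>A\<close>, which
        these columns span.\<close>
      moreover have "(\<Sum>i\<in>UNIV. x i * y $ i) = 0" if y: "map_matrix complex_of_int A *v y = 0" for y
      proof -
        have "(\<Sum>i\<in>UNIV. x i * b l $ i) = 0" if l: "l < r" for l
        proof -
          have "(\<Sum>i\<in>UNIV. x i * b l $ i) = b l $ j - (\<Sum>k<r. b k $ j * (\<Sum>i\<in>UNIV. c k $ i * b l $ i))"
          proof -
            have "(\<Sum>i\<in>UNIV. x i * b l $ i) =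
                (\<Sum>i\<in>UNIV. (if i = j then b l $ i else 0) - (\<Sum>k<r. b k $ j * (c k $ i * b l $ i)))"
              by (intro sum.cong) (auto simp: x_def left_diff_distrib sum_distrib_right mult.assoc)
            also have "\<dots> = b l $ j - (\<Sum>i\<in>UNIV. \<Sum>k<r. b k $ j * (c k $ i * b l $ i))"
              by (simp add: sum_subtractf)
            also have "\<dots> = b l $ j - (\<Sum>k<r. b k $ j * (\<Sum>i\<in>UNIV. c k $ i * b l $ i))"
              by (subst sum.swap) (simp add: sum_distrib_left)
            finally show ?thesis .
          qed
          also have "\<dots> = b l $ j - (\<Sum>k<r. if k = l then b k $ j else 0)"
            using l by (intro arg_cong2[where f="(-)"] refl sum.cong) (auto simp: c)
          finally show ?thesis using l by simp
        qed
        moreover have "y \<in> vec.span (b ` {..<r})" using y span by (simp add: complex_kernel_def)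
        ultimately show ?thesis using span_sum_zero[of "b ` {..<r}" x y] by blast
      qed
      then obtain \<mu> where "x i = (\<Sum>k\<in>UNIV. \<mu> k * of_int (A $ k $ i))" for i
        using annihilator_of_kernel[of "map_matrix complex_of_int A" "\<chi> i. x i"]
        by (auto simp: map_matrix_def)
      ultimately show ?thesis using linear_in_At_ideal by metis
    qed
    from mps_hom_diff_in_ideal[OF mps_hom_comp[OF Phi_hom \<sigma>] _ At_ideal_ideal this f(1)]
    have "f \<ominus>\<^bsub>t_ring\<^esub> \<sigma> (Phi r b f) \<in> At_ideal A" by simp
    then show "f \<in> At_ideal A" using f by (simp add: t.minus_eq)
  next
    fix f assume f: "f \<in> At_ideal A"
    have "ring_hom_ring t_ring (s_ring r) (Phi r b)"
      by (rule ring_hom_ringI2[OF t.ring_axioms s.ring_axioms P.homh])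
    \<comment> \<open>The preimage of the zero ideal is an ideal, so only the generators need to be
      checked. Their images have the entries of \<open>A B\<close> as coefficients, and these vanish
      because the columns of \<open>B\<close> lie in the kernel.\<close>
    from ring_hom_ring.ideal_vimage[OF this s.zeroideal]
    have "At_ideal A \<subseteq> {f \<in> carrier t_ring. Phi r b f \<in> {\<zero>\<^bsub>s_ring r\<^esub>}}"
      unfolding At_ideal_def
    proof (rule t.genideal_minimal)
      have "Phi r b (mps_linear UNIV (\<lambda>j. of_int (A $ i $ j))) = \<zero>\<^bsub>s_ring r\<^esub>" for i
        unfolding Phi_linear using bk by (simp add: mps_linear_eq mem_complex_kernel_iff mps_ring_simps(4))
      then show "range (\<lambda>i. mps_linear UNIV (\<lambda>j. of_int (A $ i $ j)))
          \<subseteq> {f \<in> carrier t_ring. Phi r b f \<in> {\<zero>\<^bsub>s_ring r\<^esub>}}"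
        using mps_linear_closed by blast
    qed
    with f show "f \<in> a_kernel t_ring (s_ring r) (Phi r b)"
      unfolding a_kernel_def' by blast
  qed
qed

section \<open>Equality of the colon ideals\<close>

theorem corollary6p7:
  fixes A :: "int^'n::finite^'d::finite"
    and \<beta> :: "complex^'d"
    and w :: "real^'n"
    and v\<^sub>0 :: "complex^'n"
    and b :: "nat \<Rightarrow> complex^'n"
    and N :: "'n set set"
    and r :: nat
  assumes rank_A: "rank (map_matrix rat_of_int A) = CARD('d)"
    and hyperplane: "columns_on_hyperplane A"
    and generic: "generic_weight A w"
    and fake: "fake_exponent A \<beta> w v\<^sub>0"
    and r_def: "r = CARD('n) - CARD('d)"
    and basis: "is_basis_of r b (complex_kernel A)"
    and family: "negative_support_family A w v\<^sub>0 N"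
    and ordered: "ordered_family A v\<^sub>0 N"
    and inter: "At_ideal A \<inter> M_hat N = At_ideal A \<cdot>\<^bsub>t_ring\<^esub> M_hat N"
  shows "Phi r b ` ideal_colon t_ring (Q_hat A v\<^sub>0 N) (m_hat v\<^sub>0 N)
       = ideal_colon (s_ring r) (P_s r b A v\<^sub>0 N) (m_s r b v\<^sub>0 N)"
proof -
  interpret t: cring "t_ring :: ('n, complex) mps ring" by (rule cring_mps_ring)
  interpret P: mps_hom UNIV "{..<r}" "Phi r b" by (rule Phi_hom)
  note surj = Phi_surj_kernel(1)[OF basis] and ker = Phi_surj_kernel(2)[OF basis]
  have var: "mps_var j \<in> carrier t_ring" for j :: 'n by (simp add: mps_var_closed)
  have M: "ideal (M_hat N) t_ring"
    unfolding M_hat_def M_ideal_def using var by (intro t.genideal_ideal) auto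
  have P: "ideal (P_hat A v\<^sub>0 N) t_ring"
    unfolding P_hat_def P_ideal_def using var by (intro t.genideal_ideal) auto
  have PM: "P_hat A v\<^sub>0 N \<subseteq> M_hat N"
    unfolding P_hat_def M_hat_def by (rule t.P_ideal_subset_M_ideal[OF var])
  have m: "m_hat v\<^sub>0 N \<in> M_hat N"
    unfolding m_hat_def M_hat_def
    by (rule t.m_elem_in_M_ideal[OF var]) (use family in \<open>simp add: negative_support_family_def\<close>)
  have "Phi r b ` P_hat A v\<^sub>0 N = P_s r b A v\<^sub>0 N"
    unfolding P_hat_def P_s_def using P.image_P_ideal[OF surj var] by (simp add: Phi_var)
  moreover have "Phi r b (m_hat v\<^sub>0 N) = m_s r b v\<^sub>0 N"
    unfolding m_hat_def m_s_def m_elem_def using var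
    by (subst P.hom_finprod) (auto simp: o_def Phi_var)
  ultimately show ?thesis
    using P.image_ideal_colon[OF surj ker At_ideal_ideal M P PM m inter]
    unfolding Q_hat_def by simp
qed

end
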